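(* Assume $\overline m\in\mathcal{D}_\kappa$. 1. For any $\eta\in\Omega_{\mathcal{C}}^{\mathrm{typ}}$, we have $\mathcal{P}\mathcal{E}(\eta)=\eta$. 2. For any $\xi\in\Omega^{\iota\mathrm{typ}}$, we have $\mathcal{E}\mathcal{P}(\xi)=\xi$.
   Context: Lie-theoretic setting: $\mathfrak{g}$ is a simple finite-dimensional Lie algebra over $\mathbb{C}$ of rank $n$ with simple roots $\alpha_1,\ldots,\alpha_n$ realized in $\mathbb{R}^n$ with a scalar product $\langle\cdot,\cdot\rangle$ invariant under the Weyl group $\mathsf{W}$; $s_i$ is the reflection attached to $\alpha_i$; $w_0=s_{i_1}\cdots s_{i_r}$ is a fixed minimal length decomposition of the longest element of $\mathsf{W}$; $\alpha^\vee=2\alpha/\langle\alpha,\alpha\rangle$; $\omega_i$ are the fundamental weights, $P=\bigoplus_i\mathbb{Z}\omega_i$, $P_+=\bigoplus_i\mathbb{Z}_{\geq0}\omega_i$, $\mathcal{C}=\{x\in\mathbb{R}^n\mid\langle x,\alpha_i^\vee\rangle\geq0\ \forall i\}$ with interior $\mathring{\mathcal{C}}$. Littelmann paths: an elementary path is a continuous piecewise linear map $\pi:[0,1]\to\mathbb{R}^n$ with $\pi(0)=0$, $\pi(1)\in P$ and rational turning points; $\mathrm{wt}(\pi)=\pi(1)$. For a path $\eta$ on $[0,T]$ set $h_i(t)=\langle\eta(t),\alpha_i^\vee\rangle$ and $M_i=\min_{[0,T]}h_i$ (an integer for all paths considered). Root operator: $\tilde f_i(\eta)=\mathbf{0}$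 if $h_i(T)=M_i$, otherwise $\tilde f_i(\eta)(t)=\eta(t)-\min\{1,\inf_{s\in[t,T]}h_i(s)-M_i\}\alpha_i$. Fix $\kappa\in P_+$ and an elementary path $\pi_\kappa$ from $0$ to $\kappa$ with image in $\mathcal{C}$; $B(\pi_\kappa)$ is the finite set of all nonzero paths obtained from $\pi_\kappa$ by applying operators $\tilde f_i$. $\Omega$ is the set of infinite sequences $\pi_1\otimes\pi_2\otimes\cdots$ in $B(\pi_\kappa)$, each identified with the continuous path $[0,+\infty[\to\mathbb{R}^n$ equal to $\pi_1(1)+\cdots+\pi_k(1)+\pi_{k+1}(t-k)$ on $[k,k+1]$; $\Omega_{\mathcal{C}}\subset\Omega$ is the subset of trajectories staying in $\mathcal{C}$. Drifts: for $\beta=\sum_i\beta_i\alpha_i\in P$ and $\tau\in]0,+\infty[^n$ put $\tau^\beta=\prod_i\tau_i^{\beta_i}$. The drift of $\tau$ is $\overline m=\sum_{\pi\in B(\pi_\kappa)}p_\pi\mathrm{wt}(\pi)$ with $p_\pi=\tau^{\kappa-\mathrm{wt}(\pi)}/\sum_{\pi'\in B(\pi_\kappa)}\tau^{\kappa-\mathrm{wt}(\pi')}$; $\mathcal{M}_\kappa$ is the set of all drifts and $\mathcal{D}_\kappa=\mathcal{M}_\kappa\cap\mathring{\mathcal{C}}$. Typical trajectories, for fixed $\overline m\in\mathcal{D}_\kappa$: $\Omega_{\mathcal{C}}^{\mathrm{typ}}=\{\pi\in\Omega_{\mathcal{C}}\mid\lim_{\ell\to+\infty}\frac1\ell\langle\pi(\ell),\alpha_i^\vee\rangle=\langle\overline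 m,\alpha_i^\vee\rangle\ \forall i\}$ and $\Omega^{\iota\mathrm{typ}}=\{\pi\in\Omega\mid\lim_{\ell\to+\infty}\frac1\ell\langle\pi(\ell),\alpha_i^\vee\rangle=\langle w_0(\overline m),\alpha_i^\vee\rangle\ \forall i\}$ (so the limits are $>0$, respectively $<0$). Transforms on infinite paths: $\mathcal{P}_\alpha(\eta)(t)=\eta(t)-\inf_{s\in[0,t]}\langle\eta(s),\alpha^\vee\rangle\alpha$ and $\mathcal{P}=\mathcal{P}_{\alpha_{i_1}}\cdots\mathcal{P}_{\alpha_{i_r}}$. If $\lim_{t\to\infty}\langle\eta(t),\alpha^\vee\rangle=+\infty$, $\mathcal{E}_\alpha(\eta)(t)=\eta(t)-\inf_{s\in[t,+\infty[}\langle\eta(s),\alpha^\vee\rangle\alpha+\inf_{s\in[0,+\infty[}\langle\eta(s),\alpha^\vee\rangle\alpha$, and $\mathcal{E}=\mathcal{E}_{\alpha_{i_1}}\cdots\mathcal{E}_{\alpha_{i_r}}$ (well defined on $\Omega_{\mathcal{C}}^{\mathrm{typ}}$). *)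

theory Defs
  imports "HOL-Analysis.Analysis"
begin

section \<open>Simple complex Lie algebras and their simple roots\<close>

locale lie_algebra = vector_space scl
  for scl :: "complex \<Rightarrow> 'g::ab_group_add \<Rightarrow> 'g" +
  fixes bracket :: "'g \<Rightarrow> 'g \<Rightarrow> 'g"
  assumes bracket_add_left: "bracket (x + y) z = bracket x z + bracket y z"
    and bracket_add_right: "bracket x (y + z) = bracket x y + bracket x z"
    and bracket_scale_left: "bracket (scl c x) y = scl c (bracket x y)"
    and bracket_scale_right: "bracket x (scl c y) = scl c (bracket x y)"
    and bracket_self: "bracket x x = 0"
    and jacobi: "bracket x (bracket y z) + bracket y (bracket z x) + bracket z (bracket x y) = 0"
begin

definition lie_ideal :: "'g set \<Rightarrow> bool" where
  "lie_ideal I \<longleftrightarrow> subspace I \<and> (\<forall>x. \<forall>y\<in>I. bracket x y \<in> I)"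

definition lie_subalgebra :: "'g set \<Rightarrow> bool" where
  "lie_subalgebra L \<longleftrightarrow> subspace L \<and> (\<forall>x\<in>L. \<forall>y\<in>L. bracket x y \<in> L)"

primrec lower_central :: "'g set \<Rightarrow> nat \<Rightarrow> 'g set" where
  "lower_central L 0 = L"
| "lower_central L (Suc k) = span {bracket x y | x y. x \<in> L \<and> y \<in> lower_central L k}"

definition cartan_subalgebra :: "'g set \<Rightarrow> bool" where
  "cartan_subalgebra H \<longleftrightarrow>
     lie_subalgebra H \<and> (\<exists>k. lower_central H k = {0}) \<and> {x. \<forall>h\<in>H. bracket x h \<in> H} = H"

text \<open>Linear functionals on a Cartan subalgebra \<open>H\<close> are represented by functions on the whole
  Lie algebra of which only the values on \<open>H\<close> matter.\<close>

definition is_root :: "'g set \<Rightarrow> ('g \<Rightarrow> complex) \<Rightarrow> bool" where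
  "is_root H l \<longleftrightarrow>
     (\<exists>h\<in>H. l h \<noteq> 0) \<and> (\<exists>x. x \<noteq> 0 \<and> (\<forall>h\<in>H. bracket h x = scl (l h) x))"

definition simple_roots :: "'g set \<Rightarrow> ('n::finite \<Rightarrow> 'g \<Rightarrow> complex) \<Rightarrow> bool" where
  "simple_roots H a \<longleftrightarrow>
     (\<forall>i. is_root H (a i)) \<and>
     (\<forall>c :: 'n \<Rightarrow> complex. (\<forall>h\<in>H. (\<Sum>i\<in>UNIV. c i * a i h) = 0) \<longrightarrow> (\<forall>i. c i = 0)) \<and>
     (\<forall>l. is_root H l \<longrightarrow>
        (\<exists>c :: 'n \<Rightarrow> int. (\<forall>h\<in>H. l h = (\<Sum>i\<in>UNIV. of_int (c i) * a i h)) \<and>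
           ((\<forall>i. 0 \<le> c i) \<or> (\<forall>i. c i \<le> 0))))"

end

locale simple_lie_algebra = lie_algebra +
  assumes finite_dim: "\<exists>B. finite B \<and> span B = UNIV"
    and non_abelian: "\<exists>x y. bracket x y \<noteq> 0"
    and no_ideals: "lie_ideal I \<Longrightarrow> I = {0} \<or> I = UNIV"


section \<open>Realization of the roots in Euclidean space, Weyl group, weights\<close>

definition coroot :: "'a::euclidean_space \<Rightarrow> 'a" where
  "coroot b = (2 / (b \<bullet> b)) *\<^sub>R b"

definition reflection :: "'a::euclidean_space \<Rightarrow> 'a \<Rightarrow> 'a" where
  "reflection b x = x - (x \<bullet> coroot b) *\<^sub>R b"

text \<open>\<open>realized_roots\<close> is the image of the root system of the Lie algebra under the additive map
  sending the simple root \<open>a i\<close> to the vector \<open>\<alpha> i\<close>. In \<open>root_realization\<close>, the invariance of the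
  scalar product under the Weyl group is expressed by requiring that the orthogonal reflections in
  the roots preserve the roots: as the roots span and are finite in number, each such reflection is
  then the action of the corresponding Weyl group element.\<close>

definition realized_roots ::
  "(complex \<Rightarrow> 'g::ab_group_add \<Rightarrow> 'g) \<Rightarrow> ('g \<Rightarrow> 'g \<Rightarrow> 'g) \<Rightarrow> 'g set \<Rightarrow>
   ('n::finite \<Rightarrow> 'g \<Rightarrow> complex) \<Rightarrow> ('n \<Rightarrow> 'a::euclidean_space) \<Rightarrow> 'a set" where
  "realized_roots scl bracket H a \<alpha> =
     {(\<Sum>i\<in>UNIV. of_int (c i) *\<^sub>R \<alpha> i) | c :: 'n \<Rightarrow> int.
        lie_algebra.is_root scl bracket H (\<lambda>h. \<Sum>i\<in>UNIV. of_int (c i) * a i h)}"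

definition root_realization ::
  "(complex \<Rightarrow> 'g::ab_group_add \<Rightarrow> 'g) \<Rightarrow> ('g \<Rightarrow> 'g \<Rightarrow> 'g) \<Rightarrow> 'g set \<Rightarrow>
   ('n::finite \<Rightarrow> 'g \<Rightarrow> complex) \<Rightarrow> ('n \<Rightarrow> 'a::euclidean_space) \<Rightarrow> bool" where
  "root_realization scl bracket H a \<alpha> \<longleftrightarrow>
     inj \<alpha> \<and> independent (range \<alpha>) \<and> span (range \<alpha>) = UNIV \<and>
     (\<forall>\<beta>\<in>realized_roots scl bracket H a \<alpha>.
        reflection \<beta> ` realized_roots scl bracket H a \<alpha> = realized_roots scl bracket H a \<alpha>)"

definition weyl_word :: "('n \<Rightarrow> 'a::euclidean_space) \<Rightarrow> 'n list \<Rightarrow> 'a \<Rightarrow> 'a" where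
  "weyl_word \<alpha> ws = foldr (\<lambda>i. reflection (\<alpha> i)) ws"

definition weyl_group :: "('n \<Rightarrow> 'a::euclidean_space) \<Rightarrow> ('a \<Rightarrow> 'a) set" where
  "weyl_group \<alpha> = range (weyl_word \<alpha>)"

definition weyl_length :: "('n \<Rightarrow> 'a::euclidean_space) \<Rightarrow> ('a \<Rightarrow> 'a) \<Rightarrow> nat" where
  "weyl_length \<alpha> w = (LEAST k. \<exists>ws. length ws = k \<and> weyl_word \<alpha> ws = w)"

definition longest_element :: "('n \<Rightarrow> 'a::euclidean_space) \<Rightarrow> ('a \<Rightarrow> 'a) \<Rightarrow> bool" where
  "longest_element \<alpha> w \<longleftrightarrow>
     w \<in> weyl_group \<alpha> \<and> (\<forall>v\<in>weyl_group \<alpha>. weyl_length \<alpha> v \<le> weyl_length \<alpha> w)"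

definition reduced_decomposition ::
  "('n \<Rightarrow> 'a::euclidean_space) \<Rightarrow> ('a \<Rightarrow> 'a) \<Rightarrow> 'n list \<Rightarrow> bool" where
  "reduced_decomposition \<alpha> w ws \<longleftrightarrow> weyl_word \<alpha> ws = w \<and> length ws = weyl_length \<alpha> w"

definition fundamental_weight :: "('n::finite \<Rightarrow> 'a::euclidean_space) \<Rightarrow> 'n \<Rightarrow> 'a" where
  "fundamental_weight \<alpha> i = (THE w. \<forall>j. w \<bullet> coroot (\<alpha> j) = (if j = i then 1 else 0))"

definition weight_lattice :: "('n::finite \<Rightarrow> 'a::euclidean_space) \<Rightarrow> 'a set" where
  "weight_lattice \<alpha> =
     range (\<lambda>k :: 'n \<Rightarrow> int. \<Sum>i\<in>UNIV. of_int (k i) *\<^sub>R fundamental_weight \<alpha> i)"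

definition dominant_weights :: "('n::finite \<Rightarrow> 'a::euclidean_space) \<Rightarrow> 'a set" where
  "dominant_weights \<alpha> =
     range (\<lambda>k :: 'n \<Rightarrow> nat. \<Sum>i\<in>UNIV. of_nat (k i) *\<^sub>R fundamental_weight \<alpha> i)"

definition rational_weights :: "('n::finite \<Rightarrow> 'a::euclidean_space) \<Rightarrow> 'a set" where
  "rational_weights \<alpha> =
     range (\<lambda>q :: 'n \<Rightarrow> rat. \<Sum>i\<in>UNIV. of_rat (q i) *\<^sub>R fundamental_weight \<alpha> i)"

definition weyl_chamber :: "('n::finite \<Rightarrow> 'a::euclidean_space) \<Rightarrow> 'a set" where
  "weyl_chamber \<alpha> = {x. \<forall>i. 0 \<le> x \<bullet> coroot (\<alpha> i)}"


section \<open>Littelmann paths\<close>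

text \<open>A path on \<open>[0,T]\<close> is a function on the reals whose values outside \<open>{0..T}\<close> are fixed by
  extensionality, so that equality of paths is equality of functions and sums over sets of paths
  count each path once.

  Rationality of the turning points means that they lie in the rational span of the weight
  lattice. The points of subdivision below may be taken to be the turning points and the two
  endpoints, which belong to the weight lattice.\<close>

definition elementary_path :: "('n::finite \<Rightarrow> 'a::euclidean_space) \<Rightarrow> (real \<Rightarrow> 'a) \<Rightarrow> bool" where
  "elementary_path \<alpha> \<pi> \<longleftrightarrow>
     \<pi> \<in> extensional {0..1} \<and> continuous_on {0..1} \<pi> \<and> \<pi> 0 = 0 \<and> \<pi> 1 \<in> weight_lattice \<alpha> \<and>
     (\<exists>(N::nat) t. t 0 = 0 \<and> t N = 1 \<and> (\<forall>j<N. t j < t (Suc j)) \<and>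
        (\<forall>j\<le>N. \<pi> (t j) \<in> rational_weights \<alpha>) \<and>
        (\<forall>j<N. \<forall>u\<in>{0..1}. \<pi> ((1 - u) * t j + u * t (Suc j)) =
           (1 - u) *\<^sub>R \<pi> (t j) + u *\<^sub>R \<pi> (t (Suc j))))"

definition path_weight :: "(real \<Rightarrow> 'a) \<Rightarrow> 'a" where
  "path_weight \<pi> = \<pi> 1"

text \<open>The root operator \<open>f\<^sub>i\<close> for the root \<open>b = \<alpha> i\<close> on paths on \<open>[0,T]\<close>; \<open>None\<close> is the zero
  element \<open>0\<close>. The infimum \<open>M\<close> is a minimum, paths being continuous.\<close>

definition root_op ::
  "real \<Rightarrow> 'a::euclidean_space \<Rightarrow> (real \<Rightarrow> 'a) \<Rightarrow> (real \<Rightarrow> 'a) option" where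
  "root_op T b \<eta> =
     (let h = (\<lambda>t. \<eta> t \<bullet> coroot b); M = (INF t\<in>{0..T}. h t) in
      if h T = M then None
      else Some (restrict (\<lambda>t. \<eta> t - min 1 ((INF s\<in>{t..T}. h s) - M) *\<^sub>R b) {0..T}))"

inductive_set crystal :: "('n::finite \<Rightarrow> 'a::euclidean_space) \<Rightarrow> (real \<Rightarrow> 'a) \<Rightarrow> (real \<Rightarrow> 'a) set"
  for \<alpha> :: "'n \<Rightarrow> 'a" and \<pi>\<^sub>\<kappa> :: "real \<Rightarrow> 'a" where
  start: "\<pi>\<^sub>\<kappa> \<in> crystal \<alpha> \<pi>\<^sub>\<kappa>"
| step: "\<eta> \<in> crystal \<alpha> \<pi>\<^sub>\<kappa> \<Longrightarrow> root_op 1 (\<alpha> i) \<eta> = Some \<eta>' \<Longrightarrow> \<eta>' \<in> crystal \<alpha> \<pi>\<^sub>\<kappa>"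

text \<open>Infinite paths are functions of which only the values on \<open>{0..}\<close> matter; a concatenation is
  given the value \<open>0\<close> at negative times. The sequence \<open>p\<close> is indexed from \<open>0\<close>.\<close>

definition concat_paths :: "(nat \<Rightarrow> real \<Rightarrow> 'a::euclidean_space) \<Rightarrow> real \<Rightarrow> 'a" where
  "concat_paths p t =
     (if t < 0 then 0
      else (\<Sum>j<nat \<lfloor>t\<rfloor>. p j 1) + p (nat \<lfloor>t\<rfloor>) (t - of_int \<lfloor>t\<rfloor>))"

definition traj :: "('n::finite \<Rightarrow> 'a::euclidean_space) \<Rightarrow> (real \<Rightarrow> 'a) \<Rightarrow> (real \<Rightarrow> 'a) set" where
  "traj \<alpha> \<pi>\<^sub>\<kappa> = {concat_paths p | p. \<forall>k. p k \<in> crystal \<alpha> \<pi>\<^sub>\<kappa>}"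

definition traj_chamber ::
  "('n::finite \<Rightarrow> 'a::euclidean_space) \<Rightarrow> (real \<Rightarrow> 'a) \<Rightarrow> (real \<Rightarrow> 'a) set" where
  "traj_chamber \<alpha> \<pi>\<^sub>\<kappa> = {\<eta> \<in> traj \<alpha> \<pi>\<^sub>\<kappa>. \<forall>t\<ge>0. \<eta> t \<in> weyl_chamber \<alpha>}"


section \<open>Drifts and typical trajectories\<close>

text \<open>\<open>\<tau>\<close> to the power \<open>\<beta>\<close>, through the coordinates of \<open>\<beta>\<close> in the basis of simple roots.\<close>

definition tau_power :: "('n::finite \<Rightarrow> 'a::euclidean_space) \<Rightarrow> ('n \<Rightarrow> real) \<Rightarrow> 'a \<Rightarrow> real" where
  "tau_power \<alpha> \<tau> \<beta> = (\<Prod>i\<in>UNIV. \<tau> i powr representation (range \<alpha>) \<beta> (\<alpha> i))"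

definition path_prob ::
  "('n::finite \<Rightarrow> 'a::euclidean_space) \<Rightarrow> 'a \<Rightarrow> (real \<Rightarrow> 'a) \<Rightarrow> ('n \<Rightarrow> real) \<Rightarrow> (real \<Rightarrow> 'a) \<Rightarrow> real" where
  "path_prob \<alpha> \<kappa> \<pi>\<^sub>\<kappa> \<tau> \<pi> =
     tau_power \<alpha> \<tau> (\<kappa> - path_weight \<pi>) /
     (\<Sum>\<pi>'\<in>crystal \<alpha> \<pi>\<^sub>\<kappa>. tau_power \<alpha> \<tau> (\<kappa> - path_weight \<pi>'))"

definition drift ::
  "('n::finite \<Rightarrow> 'a::euclidean_space) \<Rightarrow> 'a \<Rightarrow> (real \<Rightarrow> 'a) \<Rightarrow> ('n \<Rightarrow> real) \<Rightarrow> 'a" where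
  "drift \<alpha> \<kappa> \<pi>\<^sub>\<kappa> \<tau> = (\<Sum>\<pi>\<in>crystal \<alpha> \<pi>\<^sub>\<kappa>. path_prob \<alpha> \<kappa> \<pi>\<^sub>\<kappa> \<tau> \<pi> *\<^sub>R path_weight \<pi>)"

definition drifts :: "('n::finite \<Rightarrow> 'a::euclidean_space) \<Rightarrow> 'a \<Rightarrow> (real \<Rightarrow> 'a) \<Rightarrow> 'a set" where
  "drifts \<alpha> \<kappa> \<pi>\<^sub>\<kappa> = {drift \<alpha> \<kappa> \<pi>\<^sub>\<kappa> \<tau> | \<tau>. \<forall>i. 0 < \<tau> i}"

definition chamber_drifts :: "('n::finite \<Rightarrow> 'a::euclidean_space) \<Rightarrow> 'a \<Rightarrow> (real \<Rightarrow> 'a) \<Rightarrow> 'a set" where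
  "chamber_drifts \<alpha> \<kappa> \<pi>\<^sub>\<kappa> = drifts \<alpha> \<kappa> \<pi>\<^sub>\<kappa> \<inter> interior (weyl_chamber \<alpha>)"

definition has_mean :: "('n::finite \<Rightarrow> 'a::euclidean_space) \<Rightarrow> 'a \<Rightarrow> (real \<Rightarrow> 'a) \<Rightarrow> bool" where
  "has_mean \<alpha> v \<eta> \<longleftrightarrow>
     (\<forall>i. (\<lambda>l::nat. (\<eta> (real l) \<bullet> coroot (\<alpha> i)) / real l) \<longlonglongrightarrow> v \<bullet> coroot (\<alpha> i))"

definition traj_chamber_typ ::
  "('n::finite \<Rightarrow> 'a::euclidean_space) \<Rightarrow> (real \<Rightarrow> 'a) \<Rightarrow> 'a \<Rightarrow> (real \<Rightarrow> 'a) set" where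
  "traj_chamber_typ \<alpha> \<pi>\<^sub>\<kappa> m = {\<eta> \<in> traj_chamber \<alpha> \<pi>\<^sub>\<kappa>. has_mean \<alpha> m \<eta>}"

definition traj_iota_typ ::
  "('n::finite \<Rightarrow> 'a::euclidean_space) \<Rightarrow> (real \<Rightarrow> 'a) \<Rightarrow> ('a \<Rightarrow> 'a) \<Rightarrow> 'a \<Rightarrow> (real \<Rightarrow> 'a) set" where
  "traj_iota_typ \<alpha> \<pi>\<^sub>\<kappa> w\<^sub>0 m = {\<eta> \<in> traj \<alpha> \<pi>\<^sub>\<kappa>. has_mean \<alpha> (w\<^sub>0 m) \<eta>}"


section \<open>The transforms on infinite paths\<close>

definition pitman :: "'a::euclidean_space \<Rightarrow> (real \<Rightarrow> 'a) \<Rightarrow> real \<Rightarrow> 'a" where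
  "pitman b \<eta> t = \<eta> t - (INF s\<in>{0..t}. \<eta> s \<bullet> coroot b) *\<^sub>R b"

definition pitman_word :: "('n \<Rightarrow> 'a::euclidean_space) \<Rightarrow> 'n list \<Rightarrow> (real \<Rightarrow> 'a) \<Rightarrow> real \<Rightarrow> 'a" where
  "pitman_word \<alpha> ws = foldr (\<lambda>i. pitman (\<alpha> i)) ws"

text \<open>The second transform is partial: \<open>None\<close> when \<open>\<langle>\<eta>(t), b\<^sup>\<or>\<rangle>\<close> does not tend to infinity.
  In the composition along a word the last letter acts first, and the result is \<open>None\<close> as soon as
  one of the factors is undefined.\<close>

definition etrans :: "'a::euclidean_space \<Rightarrow> (real \<Rightarrow> 'a) \<Rightarrow> (real \<Rightarrow> 'a) option" where
  "etrans b \<eta> =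
     (if filterlim (\<lambda>t. \<eta> t \<bullet> coroot b) at_top at_top
      then Some (\<lambda>t. \<eta> t - (INF s\<in>{t..}. \<eta> s \<bullet> coroot b) *\<^sub>R b
                         + (INF s\<in>{0..}. \<eta> s \<bullet> coroot b) *\<^sub>R b)
      else None)"

definition etrans_word ::
  "('n \<Rightarrow> 'a::euclidean_space) \<Rightarrow> 'n list \<Rightarrow> (real \<Rightarrow> 'a) \<Rightarrow> (real \<Rightarrow> 'a) option" where
  "etrans_word \<alpha> ws \<eta> = foldr (\<lambda>i z. Option.bind z (etrans (\<alpha> i))) ws (Some \<eta>)"

end

theory Submission
  imports Defs
begin

text \<open>For paths with drift the one-root transforms satisfy \<open>E\<^sub>\<alpha> P\<^sub>\<alpha> \<xi> = \<xi>\<close> when \<open>\<xi>\<close> drifts to the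
  negative side of \<open>\<alpha>\<close>, and \<open>P\<^sub>\<alpha> E\<^sub>\<alpha> \<eta> = P\<^sub>\<alpha> \<eta>\<close> when \<open>\<eta>\<close> drifts to the positive side. The transforms
  \<open>P\<^sub>\<alpha>\<close> satisfy the braid relations on all continuous paths (Biane, Bougerol and O'Connell): an
  alternating product in rank two has an explicit formula with nested infima, whose last coefficient
  vanishes at the order of the braid. By confluence of the descents from the antidominant to the
  dominant chamber, \<open>P\<close> does not depend on the reduced word of \<open>w\<^sub>0\<close>; in particular the word may be
  reversed, so that \<open>E P\<close> telescopes, and any root may act first, so that \<open>P E\<^sub>\<alpha> = P\<close> and hence
  \<open>P E \<eta> = P \<eta> = \<eta>\<close> for dominant \<open>\<eta>\<close>.\<close>

subsection \<open>Running infima\<close>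

text \<open>In \<open>E P\<close> the same word is read twice in the same order, so the factors that
  meet are \<open>E\<close> for its last letter and \<open>P\<close> for its first one, and nothing
  cancels as it stands; this is why the word of \<open>P\<close> has to be reversed. The product
  \<open>P E\<close> does not telescope: for a path drifting to the positive side, a one-root
  \<open>P\<close> after the matching \<open>E\<close> gives back \<open>P\<close> of the path
  rather than the path. So the letters of \<open>E\<close> are absorbed one by one into the whole of
  \<open>P\<close>, which is possible once \<open>P\<close> can be made to begin with any letter.
  Every one-root identity requires a sign of the drift. The drift vector is therefore carried along:
  each transform reflects it, and it moves through the Weyl orbit of the regular vector
  \<open>m\<close>, where no pairing with a simple coroot vanishes. Roots of different lengths would
  make the rank two formula asymmetric. Since \<open>pitman\<close> depends only on the ray spanned
  by the root, roots are normalised there to length one, and both pairings become the same number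
  \<open>- c\<close>.\<close>

definition past_inf :: "(real \<Rightarrow> real) \<Rightarrow> real \<Rightarrow> real" where
  "past_inf h t = (INF s\<in>{0..t}. h s)"

definition future_inf :: "(real \<Rightarrow> real) \<Rightarrow> real \<Rightarrow> real" where
  "future_inf h t = (INF s\<in>{t..}. h s)"

text \<open>On the reals \<open>INF\<close> is meaningful only for nonempty sets bounded below.
  Every infimum in the sequel is evaluated as an attained minimum, which settles these side
  conditions.\<close>

lemma Inf_image_attained:
  fixes h :: "real \<Rightarrow> real"
  assumes "s \<in> S" "\<And>r. r \<in> S \<Longrightarrow> h s \<le> h r"
  shows "(INF r\<in>S. h r) = h s"
  using assms by (intro cInf_eq_minimum) auto

lemma interval_inf_attained:
  fixes h :: "real \<Rightarrow> real"
  assumes "continuous_on {a..b} h" "a \<le> b"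
  obtains s where "s \<in> {a..b}" "(INF r\<in>{a..b}. h r) = h s" "\<And>r. r \<in> {a..b} \<Longrightarrow> h s \<le> h r"
proof -
  obtain s where "s \<in> {a..b}" "\<And>r. r \<in> {a..b} \<Longrightarrow> h s \<le> h r"
    using continuous_attains_inf[of "{a..b}" h] assms by auto
  then show thesis using that Inf_image_attained by metis
qed

lemma past_inf_attained:
  assumes "continuous_on {0..} h" "0 \<le> t"
  obtains s where "0 \<le> s" "s \<le> t" "past_inf h t = h s"
proof -
  have "continuous_on {0..t} h" by (rule continuous_on_subset[OF assms(1)]) auto
  then show thesis
    using interval_inf_attained[of 0 t h] that assms(2) unfolding past_inf_def
    by (metis atLeastAtMost_iff)
qed

lemma past_inf_le:
  assumes "continuous_on {0..} h" "0 \<le> s" "s \<le> t"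
  shows "past_inf h t \<le> h s"
proof -
  have "continuous_on {0..t} h" by (rule continuous_on_subset[OF assms(1)]) auto
  then show ?thesis
    using interval_inf_attained[of 0 t h] assms unfolding past_inf_def
    by (metis atLeastAtMost_iff order_trans)
qed

lemma past_inf_antimono:
  assumes "continuous_on {0..} h" "0 \<le> s" "s \<le> t"
  shows "past_inf h t \<le> past_inf h s"
  using past_inf_attained[OF assms(1,2)] past_inf_le[OF assms(1)] assms(3)
  by (metis order_trans)

lemma past_inf_cong:
  assumes "\<And>s. 0 \<le> s \<Longrightarrow> s \<le> t \<Longrightarrow> f s = g s"
  shows "past_inf f t = past_inf g t"
  unfolding past_inf_def using assms by (intro INF_cong) auto

lemma past_inf_cmult:
  assumes h: "continuous_on {0..} h" and "0 \<le> c" "0 \<le> t"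
  shows "past_inf (\<lambda>s. c * h s) t = c * past_inf h t"
proof -
  obtain s where s: "0 \<le> s" "s \<le> t" "past_inf h t = h s"
    using past_inf_attained[OF h \<open>0 \<le> t\<close>] .
  have "past_inf (\<lambda>s. c * h s) t = c * h s"
    unfolding past_inf_def
    by (rule Inf_image_attained) (use s assms past_inf_le[OF h, of _ t] in \<open>auto intro!: mult_left_mono\<close>)
  with s show ?thesis by simp
qed

lemma future_inf_attained:
  assumes "continuous_on {0..} h" "filterlim h at_top at_top" "0 \<le> t"
  obtains s where "t \<le> s" "future_inf h t = h s" "\<And>r. t \<le> r \<Longrightarrow> h s \<le> h r"
proof -
  have "eventually (\<lambda>s. h t \<le> h s) at_top"
    using assms(2) by (simp add: filterlim_at_top)
  then obtain T where T: "\<And>s. T \<le> s \<Longrightarrow> h t \<le> h s"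
    by (auto simp: eventually_at_top_linorder)
  have "continuous_on {t..max t T} h"
    by (rule continuous_on_subset[OF assms(1)]) (use assms(3) in auto)
  then obtain s where s: "s \<in> {t..max t T}" "\<And>r. r \<in> {t..max t T} \<Longrightarrow> h s \<le> h r"
    by (metis interval_inf_attained max.cobounded1)
  have le: "h s \<le> h r" if "t \<le> r" for r
  proof (cases "r \<le> max t T")
    case True then show ?thesis using s that by auto
  next
    case False
    then have "h t \<le> h r" by (intro T) simp
    then show ?thesis using s(2)[of t] by auto
  qed
  then have "future_inf h t = h s"
    unfolding future_inf_def by (intro Inf_image_attained) (use s in auto)
  then show thesis using that s le by auto
qed

lemma future_inf_le:
  assumes "continuous_on {0..} h" "filterlim h at_top at_top" "0 \<le> t" "t \<le> s"
  shows "future_inf h t \<le> h s"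
  using future_inf_attained[OF assms(1-3)] assms(4) by metis

lemma future_inf_mono:
  assumes "continuous_on {0..} h" "filterlim h at_top at_top" "0 \<le> s" "s \<le> t"
  shows "future_inf h s \<le> future_inf h t"
proof -
  have "0 \<le> t" using assms by simp
  then obtain r where "t \<le> r" "future_inf h t = h r" 
    by (rule future_inf_attained[OF assms(1,2)])
  then show ?thesis using future_inf_le[OF assms(1-3), of r] assms by auto
qed

lemma future_inf_cong:
  assumes "\<And>s. t \<le> s \<Longrightarrow> f s = g s"
  shows "future_inf f t = future_inf g t"
  unfolding future_inf_def using assms by (intro INF_cong) auto

text \<open>Running extrema inherit continuity since they oscillate no more than the function.\<close>

lemma continuous_on_oscillation:
  fixes f h :: "real \<Rightarrow> real"
  assumes h: "continuous_on S h" and "is_interval S"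
    and osc: "\<And>s t. s \<in> S \<Longrightarrow> t \<in> S \<Longrightarrow> s \<le> t \<Longrightarrow>
      \<exists>p\<in>{s..t}. \<exists>q\<in>{s..t}. \<bar>f t - f s\<bar> \<le> \<bar>h p - h q\<bar>"
  shows "continuous_on S f"
  unfolding continuous_on_iff
proof (intro ballI allI impI)
  fix x e :: real assume x: "x \<in> S" and "0 < e"
  then obtain d where d: "0 < d" "\<And>y. y \<in> S \<Longrightarrow> dist y x < d \<Longrightarrow> dist (h y) (h x) < e / 2"
    using h unfolding continuous_on_iff by (metis half_gt_zero)
  have "dist (f y) (f x) < e" if y: "y \<in> S" "dist y x < d" for y
  proof -
    have mem: "{min x y..max x y} \<subseteq> S"
      using \<open>is_interval S\<close> x y unfolding is_interval_1 subset_eq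
      by (metis atLeastAtMost_iff max_def min_def)
    have "min x y \<in> S" "max x y \<in> S" using x y by (auto simp: min_def max_def)
    then obtain p q where pq: "p \<in> {min x y..max x y}" "q \<in> {min x y..max x y}"
      and *: "\<bar>f (max x y) - f (min x y)\<bar> \<le> \<bar>h p - h q\<bar>"
      using osc[of "min x y" "max x y"] by (meson min.cobounded1 max.cobounded1 order_trans)
    have "dist p x < d" "dist q x < d"
      using pq y by (auto simp: dist_real_def max_def min_def split: if_splits)
    then have "dist (h p) (h x) < e / 2" "dist (h q) (h x) < e / 2"
      using d mem pq by blast+
    moreover have "\<bar>f y - f x\<bar> = \<bar>f (max x y) - f (min x y)\<bar>" by (auto simp: max_def min_def)
    ultimately show ?thesis using * unfolding dist_real_def by linarith
  qed
  then show "\<exists>d>0. \<forall>y\<in>S. dist y x < d \<longrightarrow> dist (f y) (f x) < e" using d by blast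
qed

lemma continuous_on_past_inf:
  assumes h: "continuous_on {0..} h"
  shows "continuous_on {0..} (past_inf h)"
proof (rule continuous_on_oscillation[OF h])
  fix s t :: real assume st: "s \<in> {0..}" "t \<in> {0..}" "s \<le> t"
  obtain p where p: "0 \<le> p" "p \<le> t" "past_inf h t = h p"
    using past_inf_attained[OF h, of t] st by auto
  show "\<exists>p\<in>{s..t}. \<exists>q\<in>{s..t}. \<bar>past_inf h t - past_inf h s\<bar> \<le> \<bar>h p - h q\<bar>"
  proof (cases "p \<le> s")
    case True
    then have "past_inf h t = past_inf h s"
      using past_inf_le[OF h, of p s] past_inf_antimono[OF h, of s t] p st by auto
    then show ?thesis using st by auto
  next
    case False
    \<comment> \<open>A drop of the infimum between \<open>s\<close> and \<open>t\<close> is at most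
      the drop of \<open>h\<close> from \<open>s\<close> to the new minimiser
      \<open>p\<close>.\<close>
    have "past_inf h s \<le> h s" "past_inf h t \<le> past_inf h s"
      using past_inf_le[OF h, of s s] past_inf_antimono[OF h, of s t] st by auto
    then show ?thesis using False p st by (intro bexI[of _ p] bexI[of _ s]) auto
  qed
qed (simp add: is_interval_1)

lemma continuous_on_future_inf:
  assumes h: "continuous_on {0..} h" "filterlim h at_top at_top"
  shows "continuous_on {0..} (future_inf h)"
proof (rule continuous_on_oscillation[OF h(1)])
  fix s t :: real assume st: "s \<in> {0..}" "t \<in> {0..}" "s \<le> t"
  obtain p where p: "s \<le> p" "future_inf h s = h p"
    by (rule future_inf_attained[OF h, of s]) (use st in auto)
  have mono: "future_inf h s \<le> future_inf h t" using future_inf_mono[OF h] st by auto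
  show "\<exists>p\<in>{s..t}. \<exists>q\<in>{s..t}. \<bar>future_inf h t - future_inf h s\<bar> \<le> \<bar>h p - h q\<bar>"
  proof (cases "t \<le> p")
    case True
    then have "future_inf h t = future_inf h s"
      using future_inf_le[OF h, of t p] mono p st by auto
    then show ?thesis using st by auto
  next
    case False
    have "future_inf h t \<le> h t" using future_inf_le[OF h, of t t] st by auto
    then show ?thesis using False p st mono by (intro bexI[of _ p] bexI[of _ t]) auto
  qed
qed (simp add: is_interval_1)

text \<open>Serves the finite-horizon infimum in \<open>root_op\<close>, and so the continuity of
  crystal paths.\<close>

lemma continuous_on_interval_inf:
  fixes h :: "real \<Rightarrow> real"
  assumes h: "continuous_on {0..T} h"
  shows "continuous_on {0..T} (\<lambda>t. INF s\<in>{t..T}. h s)"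
proof (rule continuous_on_oscillation[OF h])
  fix s t assume st: "s \<in> {0..T}" "t \<in> {0..T}" "s \<le> t"
  have "continuous_on {s..T} h" "continuous_on {t..T} h"
    using st by (auto intro: continuous_on_subset[OF h])
  then obtain p q where p: "p \<in> {s..T}" "(INF r\<in>{s..T}. h r) = h p" "\<And>r. r \<in> {s..T} \<Longrightarrow> h p \<le> h r"
    and q: "q \<in> {t..T}" "(INF r\<in>{t..T}. h r) = h q" "\<And>r. r \<in> {t..T} \<Longrightarrow> h q \<le> h r"
    using st by (metis interval_inf_attained atLeastAtMost_iff)
  show "\<exists>p\<in>{s..t}. \<exists>q\<in>{s..t}. \<bar>(INF r\<in>{t..T}. h r) - (INF r\<in>{s..T}. h r)\<bar> \<le> \<bar>h p - h q\<bar>"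
  proof (cases "t \<le> p")
    case True
    then have "h p = h q" using p(3)[of q] q(3)[of p] p(1) q(1) st by auto
    then show ?thesis using p(2) q(2) st by auto
  next
    case False
    have "h p \<le> h q" "h q \<le> h t" using p(3)[of q] q(3)[of t] q(1) st by auto
    then show ?thesis using False p st q(2) by (intro bexI[of _ p] bexI[of _ t]) auto
  qed
qed (simp add: is_interval_1)

text \<open>Before going below its old minimum, \<open>h\<close> crosses that level by the
  intermediate value theorem; at the first crossing after \<open>r\<close> the running infimum is
  still the old one.\<close>

lemma past_inf_first_hit:
  assumes h: "continuous_on {0..} h" and "0 \<le> r" "r \<le> t" and lt: "past_inf h t < past_inf h r"
  obtains s where "r \<le> s" "s \<le> t" "h s = past_inf h r" "past_inf h s = past_inf h r"
proof -
  let ?S = "{s \<in> {r..t}. h s = past_inf h r}"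
  have hits: "\<exists>p\<in>?S. p \<le> q" if q: "r \<le> q" "q \<le> t" "h q < past_inf h r" for q
  proof -
    have "continuous_on {r..q} h" by (rule continuous_on_subset[OF h]) (use \<open>0 \<le> r\<close> in auto)
    then obtain p where "r \<le> p" "p \<le> q" "h p = past_inf h r"
      using IVT2'[of h q "past_inf h r" r] q past_inf_le[OF h, of r r] \<open>0 \<le> r\<close> by auto
    then show ?thesis using q by auto
  qed
  obtain q where q: "0 \<le> q" "q \<le> t" "past_inf h t = h q"
    using past_inf_attained[OF h, of t] assms by auto
  have "r \<le> q" using past_inf_le[OF h, of q r] q lt by force
  then have "?S \<noteq> {}" using hits[of q] q lt by auto
  moreover have "compact ?S"
  proof -
    have c: "continuous_on {r..t} h" by (rule continuous_on_subset[OF h]) (use \<open>0 \<le> r\<close> in auto)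
    have "closed ?S" using continuous_closed_preimage_constant[OF c] by simp
    then show ?thesis by (rule compact_eq_bounded_closed[THEN iffD2, OF conjI, rotated])
      (auto intro: bounded_subset[of "{r..t}"])
  qed
  ultimately obtain s where s: "s \<in> ?S" "\<And>p. p \<in> ?S \<Longrightarrow> s \<le> p"
    using compact_attains_inf by meson
  \<comment> \<open>A smaller value before \<open>s\<close> would be preceded by a crossing, which
    cannot be earlier than the first one.\<close>
  have "past_inf h r \<le> past_inf h s"
  proof (rule ccontr)
    assume "\<not> ?thesis"
    moreover obtain p where p: "0 \<le> p" "p \<le> s" "past_inf h s = h p"
      using past_inf_attained[OF h, of s] s \<open>0 \<le> r\<close> by auto
    ultimately have lt': "h p < past_inf h r" by simp
    then have "r \<le> p" using past_inf_le[OF h, of p r] p by force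
    then obtain p' where "p' \<in> ?S" "p' \<le> p" using hits[of p] lt' p s by auto
    then have "p = s" using s p by force
    then show False using lt' s by simp
  qed
  then have "past_inf h s = past_inf h r"
    using past_inf_antimono[OF h, of r s] s \<open>0 \<le> r\<close> by auto
  then show thesis using that s by auto
qed

text \<open>The time-reversed counterpart of \<open>past_inf_first_hit\<close>, with the last
  crossing before \<open>t\<close>; the limit at infinity makes future infima attained.\<close>

lemma future_inf_last_hit:
  assumes h: "continuous_on {0..} h" "filterlim h at_top at_top"
    and "0 \<le> r" "r \<le> t" and lt: "future_inf h r < future_inf h t"
  obtains s where "r \<le> s" "s \<le> t" "h s = future_inf h t" "future_inf h s = future_inf h t"
proof -
  have t: "0 \<le> t" using assms by simp
  let ?S = "{s \<in> {r..t}. h s = future_inf h t}"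
  have hits: "\<exists>p\<in>?S. q \<le> p" if q: "r \<le> q" "q \<le> t" "h q < future_inf h t" for q
  proof -
    have "continuous_on {q..t} h" by (rule continuous_on_subset[OF h(1)]) (use \<open>0 \<le> r\<close> q in auto)
    then obtain p where "q \<le> p" "p \<le> t" "h p = future_inf h t"
      using IVT'[of h q "future_inf h t" t] q future_inf_le[OF h t order_refl] by auto
    then show ?thesis using q by (intro bexI[of _ p]) auto
  qed
  obtain q where q: "r \<le> q" "future_inf h r = h q"
    by (rule future_inf_attained[OF h \<open>0 \<le> r\<close>])
  have "q \<le> t" using future_inf_le[OF h t, of q] q lt by force
  then have "?S \<noteq> {}" using hits[of q] q lt by auto
  moreover have "compact ?S"
  proof -
    have c: "continuous_on {r..t} h" by (rule continuous_on_subset[OF h(1)]) (use \<open>0 \<le> r\<close> in auto)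
    have "closed ?S" using continuous_closed_preimage_constant[OF c] by simp
    then show ?thesis by (rule compact_eq_bounded_closed[THEN iffD2, OF conjI, rotated])
      (auto intro: bounded_subset[of "{r..t}"])
  qed
  ultimately obtain s where s: "s \<in> ?S" "\<And>p. p \<in> ?S \<Longrightarrow> p \<le> s"
    using compact_attains_sup by meson
  have "future_inf h t \<le> future_inf h s"
  proof (rule ccontr)
    assume "\<not> ?thesis"
    moreover have "0 \<le> s" using s \<open>0 \<le> r\<close> by auto
    then obtain p where p: "s \<le> p" "future_inf h s = h p"
      by (rule future_inf_attained[OF h])
    ultimately have lt': "h p < future_inf h t" by simp
    then have "p \<le> t" using future_inf_le[OF h t, of p] p by force
    then obtain p' where "p' \<in> ?S" "p \<le> p'" using hits[of p] lt' p s by auto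
    then have "p = s" using s(2)[of p'] p by simp
    then show False using lt' s by simp
  qed
  then have "future_inf h s = future_inf h t"
    using future_inf_mono[OF h, of s t] s \<open>0 \<le> r\<close> by auto
  then show thesis using that s by auto
qed

text \<open>\<open>cheb c k = sin (k \<theta>) / sin \<theta>\<close> for \<open>c = 2 cos \<theta>\<close>; the braid relation of order \<open>k\<close> comes from its
  zero at \<open>\<theta> = \<pi> / k\<close>.\<close>

fun cheb :: "real \<Rightarrow> nat \<Rightarrow> real" where
  "cheb c 0 = 0"
| "cheb c (Suc 0) = 1"
| "cheb c (Suc (Suc n)) = c * cheb c (Suc n) - cheb c n"

text \<open>The infimum over \<open>t \<ge> s\<^sub>0 \<ge> \<dots> \<ge> s\<^sub>k\<^sub>-\<^sub>1 \<ge> 0\<close> of \<open>cheb c i * x s\<^sub>0 + cheb c (i + 1) * y s\<^sub>1 + \<dots>\<close>, with \<open>x\<close> and \<open>y\<close>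
  alternating.\<close>

fun nested_inf :: "real \<Rightarrow> (real \<Rightarrow> real) \<Rightarrow> (real \<Rightarrow> real) \<Rightarrow> nat \<Rightarrow> nat \<Rightarrow> real \<Rightarrow> real" where
  "nested_inf c x y i 0 = (\<lambda>t. 0)"
| "nested_inf c x y i (Suc k) = past_inf (\<lambda>s. cheb c i * x s + nested_inf c y x (Suc i) k s)"

lemma continuous_on_nested_inf:
  assumes "continuous_on {0..} x" "continuous_on {0..} y"
  shows "continuous_on {0..} (nested_inf c x y i k)"
  using assms
  by (induction c x y i k rule: nested_inf.induct)
    (auto intro!: continuous_on_past_inf continuous_intros)

text \<open>For fixed \<open>r \<le> t\<close> the infimum of \<open>x - 2 I\<close> over \<open>{r..t}\<close>, increased by \<open>I r + I t\<close>, is that of \<open>x\<close>.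
  The two terms \<open>I r\<close> and \<open>I t\<close> will come from the neighbouring levels of a nested infimum.\<close>

lemma past_inf_exchange:
  assumes x: "continuous_on {0..} x" and Q: "continuous_on {0..} Q" and u: "0 \<le> u" and t: "0 \<le> t"
  defines "I \<equiv> past_inf x"
  shows "u * I t + past_inf (\<lambda>s. u * (x s - 2 * I s) + past_inf (\<lambda>r. u * I r + Q r) s) t
    = past_inf (\<lambda>s. u * x s + past_inf Q s) t" (is "_ + past_inf ?L t = past_inf ?R t")
proof (rule antisym)
  have I: "continuous_on {0..} I" unfolding I_def by (rule continuous_on_past_inf[OF x])
  have Q': "continuous_on {0..} (\<lambda>r. u * I r + Q r)" using I Q by (intro continuous_intros)
  have L: "continuous_on {0..} ?L" and R: "continuous_on {0..} ?R"
    using x I continuous_on_past_inf[OF Q] continuous_on_past_inf[OF Q']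
    by (auto intro!: continuous_intros)
  show "u * I t + past_inf ?L t \<le> past_inf ?R t"
  proof -
    obtain s where s: "0 \<le> s" "s \<le> t" "past_inf ?R t = ?R s"
      using past_inf_attained[OF R t] .
    obtain r where r: "0 \<le> r" "r \<le> s" "past_inf Q s = Q r"
      using past_inf_attained[OF Q s(1)] .
    \<comment> \<open>If \<open>I\<close> is constant on \<open>{r..t}\<close>, then
      \<open>q = s\<close> works. Otherwise let \<open>q\<close> be the first hit of the level
      \<open>I r\<close>: there \<open>x q - 2 * I q = - I r\<close>, and the left side collapses to
      \<open>I t\<close>.\<close>
    obtain q where q: "r \<le> q" "q \<le> t" "x q - 2 * I q + I r + I t \<le> x s"
    proof (cases "I t = I r")
      case True
      then have "I s = I r"
        using past_inf_antimono[OF x, of r s] past_inf_antimono[OF x, of s t] r s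
        by (auto simp: I_def)
      then show thesis using that[of s] True r s by auto
    next
      case False
      then have "I t < I r" using past_inf_antimono[OF x, of r t] r s by (auto simp: I_def)
      then obtain q where "r \<le> q" "q \<le> t" "x q = I r" "I q = I r"
        using past_inf_first_hit[OF x, of r t] r s unfolding I_def by auto
      then show thesis using that[of q] past_inf_le[OF x, of s t] s by (auto simp: I_def)
    qed
    have "past_inf ?L t \<le> ?L q" using past_inf_le[OF L, of q t] q r by auto
    moreover have "past_inf (\<lambda>r. u * I r + Q r) q \<le> u * I r + Q r"
      using past_inf_le[OF Q', of r q] q r by auto
    ultimately have "u * I t + past_inf ?L t \<le> u * (x q - 2 * I q + I r + I t) + Q r"
      by (simp add: algebra_simps)
    also have "\<dots> \<le> u * x s + Q r" using q u by (auto intro: mult_left_mono)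
    finally show ?thesis using s r by simp
  qed
  show "past_inf ?R t \<le> u * I t + past_inf ?L t"
  proof -
    obtain s where s: "0 \<le> s" "s \<le> t" "past_inf ?L t = ?L s"
      using past_inf_attained[OF L t] .
    obtain r where r: "0 \<le> r" "r \<le> s" "past_inf (\<lambda>r. u * I r + Q r) s = u * I r + Q r"
      using past_inf_attained[OF Q' s(1)] .
    \<comment> \<open>In the other direction \<open>q\<close> is a minimiser of \<open>x\<close> on
      \<open>{0..t}\<close>, so \<open>x q = I t\<close>; what remains is
      \<open>2 * I s \<le> x s + I r\<close>.\<close>
    obtain q where q: "r \<le> q" "q \<le> t" "x q \<le> x s - 2 * I s + I r + I t"
    proof (cases "I t = I r")
      case True
      then have "I s = I r"
        using past_inf_antimono[OF x, of r s] past_inf_antimono[OF x, of s t] r s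
        by (auto simp: I_def)
      then show thesis using that[of s] True r s by auto
    next
      case False
      then have lt: "I t < I r" using past_inf_antimono[OF x, of r t] r s by (auto simp: I_def)
      obtain q where q: "0 \<le> q" "q \<le> t" "I t = x q"
        using past_inf_attained[OF x t] unfolding I_def by blast
      have "r \<le> q" using past_inf_le[OF x, of q r] q lt by (force simp: I_def)
      moreover have "I s \<le> I r" "I s \<le> x s"
        using past_inf_antimono[OF x, of r s] past_inf_le[OF x, of s s] r s by (auto simp: I_def)
      ultimately show thesis using that[of q] q by auto
    qed
    have "past_inf ?R t \<le> ?R q" using past_inf_le[OF R, of q t] q r by auto
    moreover have "past_inf Q q \<le> Q r" using past_inf_le[OF Q, of r q] q r by auto
    moreover have "u * x q \<le> u * (x s - 2 * I s + I r + I t)" using q u by (auto intro: mult_left_mono)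
    ultimately show ?thesis using s r by (simp add: algebra_simps)
  qed
qed

text \<open>Here \<open>x'\<close> and \<open>y'\<close> are the two heights after one Pitman step
  in the direction of \<open>x\<close>; the step is absorbed as one more level. Levels are removed
  in pairs by \<open>past_inf_exchange\<close>, and nonnegative coefficients let the factors pass
  through the infima.\<close>

lemma nested_inf_step_even:
  assumes x: "continuous_on {0..} x" and y: "continuous_on {0..} y"
    and x': "\<And>s. 0 \<le> s \<Longrightarrow> x' s = x s - 2 * past_inf x s"
    and y': "\<And>s. 0 \<le> s \<Longrightarrow> y' s = y s + c * past_inf x s"
    and "even k" and "\<And>j. j \<le> i + k \<Longrightarrow> 0 \<le> cheb c j" and "0 \<le> t"
  shows "cheb c i * past_inf x t + nested_inf c x' y' i k t = nested_inf c x y i (Suc k) t"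
  using assms(5-)
proof (induction k arbitrary: i t rule: less_induct)
  case (less k)
  show ?case
  proof (cases k)
    case 0
    then show ?thesis using past_inf_cmult[OF x, of "cheb c i" t] less.prems by simp
  next
    case (Suc k1)
    then obtain k2 where k: "k = Suc (Suc k2)" "even k2" using less.prems(1) by (cases k1) auto
    define Q where "Q = (\<lambda>r. cheb c (Suc i) * y r + nested_inf c x y (Suc (Suc i)) (Suc k2) r)"
    have Q: "continuous_on {0..} Q"
      unfolding Q_def
      by (rule continuous_on_add[OF continuous_on_mult_left[OF y] continuous_on_nested_inf[OF x y]])
    \<comment> \<open>The recurrence \<open>c * cheb c (i + 1) = cheb c i + cheb c (i + 2)\<close>
      splits the correction in \<open>y'\<close>: one part is the term required by the exchange, the
      other feeds the induction hypothesis.\<close>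
    have inner: "cheb c (Suc i) * y' r + nested_inf c x' y' (Suc (Suc i)) k2 r = cheb c i * past_inf x r + Q r"
      if "0 \<le> r" for r
    proof -
      have "cheb c (Suc (Suc i)) * past_inf x r + nested_inf c x' y' (Suc (Suc i)) k2 r
          = nested_inf c x y (Suc (Suc i)) (Suc k2) r"
        using k less.prems(2) that by (intro less.IH) auto
      then show ?thesis unfolding Q_def using y'[OF that] by (simp add: algebra_simps)
    qed
    have "nested_inf c x' y' i k t
      = past_inf (\<lambda>s. cheb c i * (x s - 2 * past_inf x s)
          + past_inf (\<lambda>r. cheb c i * past_inf x r + Q r) s) t"
      unfolding k nested_inf.simps
      by (rule past_inf_cong) (auto simp: x' inner intro!: past_inf_cong)
    then have "cheb c i * past_inf x t + nested_inf c x' y' i k t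
      = past_inf (\<lambda>s. cheb c i * x s + past_inf Q s) t"
      using past_inf_exchange[OF x Q, of "cheb c i" t] less.prems by simp
    then show ?thesis unfolding k Q_def by simp
  qed
qed

text \<open>The outer level has coefficient \<open>cheb c 1 = 1\<close>, and
  \<open>cheb c 2 = c\<close>. So the correction in \<open>y'\<close> is exactly the extra term of
  the even case started at index 2, and no term is left outside.\<close>

lemma nested_inf_step_odd:
  assumes x: "continuous_on {0..} x" and y: "continuous_on {0..} y"
    and x': "\<And>s. 0 \<le> s \<Longrightarrow> x' s = x s - 2 * past_inf x s"
    and y': "\<And>s. 0 \<le> s \<Longrightarrow> y' s = y s + c * past_inf x s"
    and "odd k" and "\<And>j. j \<le> Suc k \<Longrightarrow> 0 \<le> cheb c j" and "0 \<le> t"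
  shows "nested_inf c y' x' 1 k t = nested_inf c y x 1 (Suc k) t"
proof -
  obtain k1 where k: "k = Suc k1" "even k1" using \<open>odd k\<close> by (cases k) auto
  have "y' s + nested_inf c x' y' (Suc 1) k1 s = y s + nested_inf c x y (Suc 1) (Suc k1) s"
    if "0 \<le> s" for s
  proof -
    have "cheb c (Suc 1) * past_inf x s + nested_inf c x' y' (Suc 1) k1 s
        = nested_inf c x y (Suc 1) (Suc k1) s"
      using k assms(6) that by (intro nested_inf_step_even[OF x y x' y']) auto
    then show ?thesis using y'[OF that] by simp
  qed
  then show ?thesis unfolding k by (auto intro!: past_inf_cong)
qed

text \<open>The innermost of the \<open>Suc k\<close> levels carries the coefficient
  \<open>cheb c (i + k)\<close>; when that vanishes, the level is the infimum of zero.\<close>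

lemma nested_inf_last_zero:
  assumes "cheb c (i + k) = 0" "0 \<le> t"
  shows "nested_inf c x y i (Suc k) t = nested_inf c x y i k t"
  using assms
proof (induction k arbitrary: x y i t)
  case 0
  then show ?case by (simp add: past_inf_def)
next
  case (Suc k)
  have "nested_inf c y x (Suc i) (Suc k) s = nested_inf c y x (Suc i) k s" if "0 \<le> s" for s
    using Suc that by simp
  then show ?case
    by (subst (1 2) nested_inf.simps(2)) (auto intro!: past_inf_cong simp del: nested_inf.simps)
qed

subsection \<open>Braid relations\<close>

text \<open>A class stable under \<open>pitman\<close>, and under the second transform where the
  height tends to infinity, so that identities for single letters can be composed. Negative times
  are left free.\<close>

definition good_path :: "(real \<Rightarrow> 'a::euclidean_space) \<Rightarrow> bool" where
  "good_path \<eta> \<longleftrightarrow> continuous_on {0..} \<eta> \<and> \<eta> 0 = 0"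

lemma continuous_on_height:
  "good_path \<eta> \<Longrightarrow> continuous_on {0..} (\<lambda>t. \<eta> t \<bullet> v)"
  by (auto simp: good_path_def intro!: continuous_intros)

lemma coroot_self: "b \<noteq> 0 \<Longrightarrow> b \<bullet> coroot b = 2"
  by (simp add: coroot_def)

lemma coroot_scaleR: "coroot (r *\<^sub>R b) = (1 / r) *\<^sub>R coroot b"
  by (simp add: coroot_def)

lemma reflection_scaleR: "r \<noteq> 0 \<Longrightarrow> reflection (r *\<^sub>R b) = reflection b"
  by (simp add: fun_eq_iff reflection_def coroot_scaleR)

lemma pitman_past_inf: "pitman b \<eta> t = \<eta> t - past_inf (\<lambda>s. \<eta> s \<bullet> coroot b) t *\<^sub>R b"
  by (simp add: pitman_def past_inf_def)

lemma pitman_height: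
  "pitman b \<eta> t \<bullet> v = \<eta> t \<bullet> v - past_inf (\<lambda>s. \<eta> s \<bullet> coroot b) t * (b \<bullet> v)"
  by (simp add: pitman_past_inf inner_diff_left)

lemma pitman_cong:
  assumes "\<And>s. 0 \<le> s \<Longrightarrow> \<eta> s = \<eta>' s" "0 \<le> t"
  shows "pitman b \<eta> t = pitman b \<eta>' t"
  using assms past_inf_cong[of t "\<lambda>s. \<eta> s \<bullet> coroot b" "\<lambda>s. \<eta>' s \<bullet> coroot b"]
  by (simp add: pitman_past_inf)

lemma good_pitman: 
  assumes "good_path \<eta>"
  shows "good_path (pitman b \<eta>)"
  unfolding good_path_def
proof
  show "continuous_on {0..} (pitman b \<eta>)"
    unfolding pitman_past_inf[abs_def] using assms
    by (intro continuous_intros continuous_on_past_inf continuous_on_height)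
      (auto simp: good_path_def)
  show "pitman b \<eta> 0 = 0"
    using assms by (simp add: pitman_past_inf past_inf_def good_path_def)
qed

text \<open>The coroot scales by \<open>1 / r\<close>, which passes through the infimum as
  \<open>r\<close> is positive, and the root by \<open>r\<close>. This is what allows the roots to
  be normalised.\<close>

lemma pitman_scaleR:
  assumes "good_path \<eta>" "0 < r" "0 \<le> t"
  shows "pitman (r *\<^sub>R b) \<eta> t = pitman b \<eta> t"
  using past_inf_cmult[OF continuous_on_height[OF assms(1), of "coroot b"], of "1 / r" t] assms
  by (simp add: pitman_past_inf coroot_scaleR)

section \<open>Compositions along words and the explicit formula in rank two\<close>

lemma pitman_word_simps [simp]:
  "pitman_word \<alpha> [] \<eta> = \<eta>"
  "pitman_word \<alpha> (i # u) \<eta> = pitman (\<alpha> i) (pitman_word \<alpha> u \<eta>)"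
  "pitman_word \<alpha> (u @ v) \<eta> = pitman_word \<alpha> u (pitman_word \<alpha> v \<eta>)"
  by (simp_all add: pitman_word_def)

lemma weyl_word_simps [simp]:
  "weyl_word \<alpha> [] v = v"
  "weyl_word \<alpha> (i # u) v = reflection (\<alpha> i) (weyl_word \<alpha> u v)"
  "weyl_word \<alpha> (u @ u') v = weyl_word \<alpha> u (weyl_word \<alpha> u' v)"
  by (simp_all add: weyl_word_def)

lemma good_pitman_word: "good_path \<eta> \<Longrightarrow> good_path (pitman_word \<alpha> u \<eta>)"
  by (induction u) (auto intro: good_pitman)

lemma pitman_word_cong:
  assumes "\<And>s. 0 \<le> s \<Longrightarrow> \<eta> s = \<eta>' s" "0 \<le> t"
  shows "pitman_word \<alpha> u \<eta> t = pitman_word \<alpha> u \<eta>' t"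
  using assms(2) by (induction u arbitrary: t) (auto intro!: pitman_cong assms(1))

fun alt_word :: "'n \<Rightarrow> 'n \<Rightarrow> nat \<Rightarrow> 'n list" where
  "alt_word i j 0 = []"
| "alt_word i j (Suc k) = i # alt_word j i k"

lemma alt_word_snoc: "alt_word i j (Suc k) = alt_word i j k @ [if even k then i else j]"
  by (induction k arbitrary: i j) auto

text \<open>The induction adds a letter at the right end, the one acting first: it replaces the two
  heights by those of the transformed path, which is the situation of the two step lemmas. The
  parity of the length decides which coefficient receives the even step.\<close>

lemma pitman_alt_word:
  fixes \<alpha> :: "'n \<Rightarrow> 'a::euclidean_space"
  assumes nz: "\<alpha> i \<noteq> 0" "\<alpha> j \<noteq> 0"
    and c: "\<alpha> i \<bullet> coroot (\<alpha> j) = - c" "\<alpha> j \<bullet> coroot (\<alpha> i) = - c"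
    and "\<And>l. l \<le> Suc k \<Longrightarrow> 0 \<le> cheb c l" and "good_path \<eta>" and "0 \<le> t"
  shows "pitman_word \<alpha> (alt_word i j (Suc k)) \<eta> t = \<eta> t
    - nested_inf c (\<lambda>s. \<eta> s \<bullet> coroot (\<alpha> i)) (\<lambda>s. \<eta> s \<bullet> coroot (\<alpha> j)) 1 (Suc k) t *\<^sub>R \<alpha> i
    - nested_inf c (\<lambda>s. \<eta> s \<bullet> coroot (\<alpha> j)) (\<lambda>s. \<eta> s \<bullet> coroot (\<alpha> i)) 1 k t *\<^sub>R \<alpha> j"
  using assms(5-)
proof (induction k arbitrary: \<eta> t)
  case 0
  then show ?case by (simp add: pitman_past_inf)
next
  case (Suc k)
  let ?x = "\<lambda>\<eta> s. \<eta> s \<bullet> coroot (\<alpha> i)" and ?y = "\<lambda>\<eta> s. \<eta> s \<bullet> coroot (\<alpha> j)"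
  note cont = continuous_on_height[OF Suc.prems(2)]
  \<comment> \<open>Parity is needed because the word is built from the left while the new letter is
    at the right end.\<close>
  define g where "g = (if even (Suc k) then i else j)"
  define \<eta>' where "\<eta>' = pitman (\<alpha> g) \<eta>"
  have "alt_word i j (Suc (Suc k)) = alt_word i j (Suc k) @ [g]"
    unfolding g_def by (rule alt_word_snoc)
  then have "pitman_word \<alpha> (alt_word i j (Suc (Suc k))) \<eta> t = pitman_word \<alpha> (alt_word i j (Suc k)) \<eta>' t"
    by (simp add: \<eta>'_def del: alt_word.simps)
  also have "\<dots> = \<eta>' t - nested_inf c (?x \<eta>') (?y \<eta>') 1 (Suc k) t *\<^sub>R \<alpha> i
      - nested_inf c (?y \<eta>') (?x \<eta>') 1 k t *\<^sub>R \<alpha> j"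
    using Suc.prems by (intro Suc.IH) (auto simp: \<eta>'_def intro: good_pitman)
  also have "\<dots> = \<eta> t - nested_inf c (?x \<eta>) (?y \<eta>) 1 (Suc (Suc k)) t *\<^sub>R \<alpha> i
      - nested_inf c (?y \<eta>) (?x \<eta>) 1 (Suc k) t *\<^sub>R \<alpha> j"
  proof (cases "even (Suc k)")
    case True
    have \<eta>': "\<eta>' s = \<eta> s - past_inf (?x \<eta>) s *\<^sub>R \<alpha> i" for s
      using True by (simp add: \<eta>'_def g_def pitman_past_inf)
    have x': "?x \<eta>' s = ?x \<eta> s - 2 * past_inf (?x \<eta>) s"
      and y': "?y \<eta>' s = ?y \<eta> s + c * past_inf (?x \<eta>) s" for s
      using nz c by (simp_all add: \<eta>' inner_diff_left coroot_self)
    have "cheb c 1 * past_inf (?x \<eta>) t + nested_inf c (?x \<eta>') (?y \<eta>') 1 (Suc k) t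
        = nested_inf c (?x \<eta>) (?y \<eta>) 1 (Suc (Suc k)) t"
      using True Suc.prems by (intro nested_inf_step_even[OF cont cont x' y']) auto
    moreover have "nested_inf c (?y \<eta>') (?x \<eta>') 1 k t = nested_inf c (?y \<eta>) (?x \<eta>) 1 (Suc k) t"
      using True Suc.prems by (intro nested_inf_step_odd[OF cont cont x' y']) auto
    ultimately have eq: "nested_inf c (?x \<eta>) (?y \<eta>) 1 (Suc (Suc k)) t
        = past_inf (?x \<eta>) t + nested_inf c (?x \<eta>') (?y \<eta>') 1 (Suc k) t"
      "nested_inf c (?y \<eta>) (?x \<eta>) 1 (Suc k) t = nested_inf c (?y \<eta>') (?x \<eta>') 1 k t"
      by simp_all
    show ?thesis unfolding eq \<eta>'[of t] by (simp add: scaleR_add_left)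
  next
    case False
    have \<eta>': "\<eta>' s = \<eta> s - past_inf (?y \<eta>) s *\<^sub>R \<alpha> j" for s
      using False by (simp add: \<eta>'_def g_def pitman_past_inf)
    have y': "?y \<eta>' s = ?y \<eta> s - 2 * past_inf (?y \<eta>) s"
      and x': "?x \<eta>' s = ?x \<eta> s + c * past_inf (?y \<eta>) s" for s
      using nz c by (simp_all add: \<eta>' inner_diff_left coroot_self)
    have "cheb c 1 * past_inf (?y \<eta>) t + nested_inf c (?y \<eta>') (?x \<eta>') 1 k t
        = nested_inf c (?y \<eta>) (?x \<eta>) 1 (Suc k) t"
      using False Suc.prems by (intro nested_inf_step_even[OF cont cont y' x']) auto
    moreover have "nested_inf c (?x \<eta>') (?y \<eta>') 1 (Suc k) t
        = nested_inf c (?x \<eta>) (?y \<eta>) 1 (Suc (Suc k)) t"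
      using False Suc.prems by (intro nested_inf_step_odd[OF cont cont y' x']) auto
    ultimately have eq: "nested_inf c (?x \<eta>) (?y \<eta>) 1 (Suc (Suc k)) t
        = nested_inf c (?x \<eta>') (?y \<eta>') 1 (Suc k) t"
      "nested_inf c (?y \<eta>) (?x \<eta>) 1 (Suc k) t
        = past_inf (?y \<eta>) t + nested_inf c (?y \<eta>') (?x \<eta>') 1 k t"
      by simp_all
    show ?thesis unfolding eq \<eta>'[of t] by (simp add: scaleR_add_left)
  qed
  finally show ?case .
qed

text \<open>In the formula for \<open>m = Suc k\<close> letters one coefficient has
  \<open>Suc k\<close> levels and the other \<open>k\<close>. The last level of the longer one has
  coefficient \<open>cheb c m = 0\<close>; dropping it makes the formula symmetric in
  \<open>i\<close> and \<open>j\<close>.\<close>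

lemma pitman_braid_normalized:
  fixes \<alpha> :: "'n \<Rightarrow> 'a::euclidean_space"
  assumes nz: "\<alpha> i \<noteq> 0" "\<alpha> j \<noteq> 0"
    and c: "\<alpha> i \<bullet> coroot (\<alpha> j) = - c" "\<alpha> j \<bullet> coroot (\<alpha> i) = - c"
    and cheb: "\<And>l. 0 < l \<Longrightarrow> l < m \<Longrightarrow> 0 < cheb c l" "cheb c m = 0"
    and "good_path \<eta>" "0 \<le> t"
  shows "pitman_word \<alpha> (alt_word i j m) \<eta> t = pitman_word \<alpha> (alt_word j i m) \<eta> t"
proof (cases m)
  case (Suc k)
  have nonneg: "0 \<le> cheb c l" if "l \<le> Suc k" for l
    using cheb that Suc by (cases "l = 0"; cases "l = m") (auto intro: less_imp_le)
  have last: "nested_inf c x y 1 (Suc k) t = nested_inf c x y 1 k t" for x y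
    using nested_inf_last_zero[of c 1 k] cheb(2) Suc assms(8) by simp
  show ?thesis
    unfolding Suc
    by (simp only: pitman_alt_word[of \<alpha> i j c, OF nz c nonneg assms(7,8)]
        pitman_alt_word[of \<alpha> j i c, OF nz(2,1) c(2,1) nonneg assms(7,8)] last) (simp add: algebra_simps)
qed simp

text \<open>The last letter acts first, and each letter takes the vector from the negative to the
  positive side of its wall. The name refers to length: on the orbit of a regular dominant vector
  each such letter lowers \<open>weyl_length\<close>.\<close>

primrec descending :: "('n \<Rightarrow> 'a::euclidean_space) \<Rightarrow> 'n list \<Rightarrow> 'a \<Rightarrow> bool" where
  "descending \<alpha> [] v \<longleftrightarrow> True"
| "descending \<alpha> (i # u) v \<longleftrightarrow> descending \<alpha> u v \<and> weyl_word \<alpha> u v \<bullet> coroot (\<alpha> i) < 0"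

lemma descending_append [simp]:
  "descending \<alpha> (u @ u') v \<longleftrightarrow> descending \<alpha> u' v \<and> descending \<alpha> u (weyl_word \<alpha> u' v)"
  by (induction u) auto

text \<open>On a straight line in a descending direction the transforms act as reflections, so relations
  between transforms specialize to relations between reflections.\<close>

lemma pitman_word_line:
  assumes "descending \<alpha> u v" "0 \<le> t"
  shows "pitman_word \<alpha> u (\<lambda>t. t *\<^sub>R v) t = t *\<^sub>R weyl_word \<alpha> u v"
  using assms
proof (induction u arbitrary: t)
  case (Cons i u)
  define z where "z = weyl_word \<alpha> u v"
  have "pitman (\<alpha> i) (pitman_word \<alpha> u (\<lambda>t. t *\<^sub>R v)) t = pitman (\<alpha> i) (\<lambda>t. t *\<^sub>R z) t"
    using Cons by (intro pitman_cong) (auto simp: z_def)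
  moreover have "past_inf (\<lambda>s. (s *\<^sub>R z) \<bullet> coroot (\<alpha> i)) t = t * (z \<bullet> coroot (\<alpha> i))"
    unfolding past_inf_def
    by (subst Inf_image_attained[of t]) (use Cons.prems in \<open>auto simp: z_def intro!: mult_right_mono_neg\<close>)
  ultimately show ?case
    by (simp add: pitman_past_inf z_def reflection_def scaleR_diff_right)
qed simp

text \<open>Alternating reflections act on the two heights by matrices with Chebyshev entries; as
  long as these are nonnegative, negative starting heights keep the relevant height
  negative.\<close>

lemma descending_alt_word:
  fixes \<alpha> :: "'n \<Rightarrow> 'a::euclidean_space"
  assumes nz: "\<alpha> i \<noteq> 0" "\<alpha> j \<noteq> 0"
    and c: "\<alpha> i \<bullet> coroot (\<alpha> j) = - c" "\<alpha> j \<bullet> coroot (\<alpha> i) = - c"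
    and cheb: "\<And>l. 0 < l \<Longrightarrow> l < m \<Longrightarrow> 0 < cheb c l" "cheb c m = 0"
    and neg: "v \<bullet> coroot (\<alpha> i) < 0" "v \<bullet> coroot (\<alpha> j) < 0"
  shows "descending \<alpha> (alt_word i j m) v"
proof -
  \<comment> \<open>The two initial heights exchange roles with every letter; \<open>p\<close> keeps
    track of this by parity.\<close>
  define p where "p k i j = (if even k then v \<bullet> coroot (\<alpha> i) else v \<bullet> coroot (\<alpha> j))" for k :: nat and i j
  have flip: "p (Suc k) i j = p k j i" for k i j by (simp add: p_def)
  have neg': "p k i j < 0" "p k j i < 0" for k using neg by (auto simp: p_def)
  \<comment> \<open>The second height is there to close the induction. Its coefficient
    \<open>c * cheb c k - cheb c (Suc k)\<close> is the Chebyshev value at \<open>k - 1\<close>,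
    which is \<open>-1\<close> for \<open>k = 0\<close>.\<close>
  have heights: "weyl_word \<alpha> (alt_word j i k) v \<bullet> coroot (\<alpha> i)
        = cheb c (Suc k) * p k i j + cheb c k * p k j i \<and>
      weyl_word \<alpha> (alt_word j i k) v \<bullet> coroot (\<alpha> j)
        = - (cheb c k * p k i j + (c * cheb c k - cheb c (Suc k)) * p k j i)"
    if "\<alpha> i \<noteq> 0" "\<alpha> j \<noteq> 0" "\<alpha> i \<bullet> coroot (\<alpha> j) = - c" "\<alpha> j \<bullet> coroot (\<alpha> i) = - c" for k i j
    using that
  proof (induction k arbitrary: i j)
    case 0
    then show ?case by (simp add: p_def)
  next
    case (Suc k)
    show ?case
      using Suc.IH[of j i] Suc.prems
      by (simp add: reflection_def inner_diff_left coroot_self flip algebra_simps)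
  qed
  have "descending \<alpha> (alt_word i j k) v \<and> descending \<alpha> (alt_word j i k) v" if "k \<le> m" for k
    using that
  proof (induction k)
    case (Suc k)
    \<comment> \<open>At the last letter \<open>cheb c (Suc k)\<close> vanishes; strictness then
      comes from the other coefficient.\<close>
    have k: "0 < cheb c k \<or> k = 0" "0 \<le> cheb c (Suc k)"
      using cheb Suc.prems less_imp_le[OF cheb(1)] by (cases "Suc k = m"; auto)+
    have sum_neg: "cheb c (Suc k) * r + cheb c k * s < 0" if "r < 0" "s < 0" for r s
    proof (cases "k = 0")
      case True then show ?thesis using that by simp
    next
      case False
      then have "cheb c k * s < 0" "cheb c (Suc k) * r \<le> 0"
        using k that by (auto simp: mult_pos_neg mult_nonneg_nonpos)
      then show ?thesis by simp
    qed
    have "weyl_word \<alpha> (alt_word j i k) v \<bullet> coroot (\<alpha> i) < 0"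
      "weyl_word \<alpha> (alt_word i j k) v \<bullet> coroot (\<alpha> j) < 0"
      using heights[of i j k] heights[of j i k] nz c sum_neg neg'[of k] by presburger+
    then show ?case using Suc by auto
  qed auto
  then show ?thesis by simp
qed

text \<open>With \<open>c = 2 cos (pi / m)\<close> the four values of \<open>c\<^sup>2\<close>
  belong to the crystallographic orders 2, 3, 4 and 6. The polynomials are evaluated directly, so no
  trigonometry enters.\<close>

lemma braid_order_exists:
  assumes "0 \<le> c" "c\<^sup>2 \<in> {0, 1, 2, 3}"
  obtains m where "2 \<le> m" "\<And>l. 0 < l \<Longrightarrow> l < m \<Longrightarrow> 0 < cheb c l" "cheb c m = 0"
proof -
  have cheb_vals: "cheb c 2 = c" "cheb c 3 = c\<^sup>2 - 1" "cheb c 4 = c * (c\<^sup>2 - 2)"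
    "cheb c 5 = (c\<^sup>2)\<^sup>2 - 3 * c\<^sup>2 + 1" "cheb c 6 = c * (c\<^sup>2 - 1) * (c\<^sup>2 - 3)"
    by (simp_all add: eval_nat_numeral algebra_simps)
  have cases: "l = 1 \<or> l = 2 \<or> l = 3 \<or> l = 4 \<or> l = 5" if "0 < l" "l < 6" for l :: nat
    using that by linarith
  have one: "cheb c (Suc 0) = 1" by simp
  have pos: "0 < c" if "c\<^sup>2 \<noteq> 0" using that assms(1) by (simp add: less_le)
  from assms(2) consider "c\<^sup>2 = 0" | "c\<^sup>2 = 1" | "c\<^sup>2 = 2" | "c\<^sup>2 = 3" by auto
  then show thesis
  proof cases
    case 1
    have "0 < cheb c l" if "0 < l" "l < 2" for l
    proof -
      have "l = 1" using that by simp
      then show ?thesis by simp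
    qed
    then show thesis using 1 cheb_vals(1) by (intro that[of 2]) auto
  next
    case 2
    have "0 < cheb c l" if "0 < l" "l < 3" for l
      using cases[of l] that pos 2 by (auto simp: cheb_vals one simp del: cheb.simps)
    then show thesis using 2 by (intro that[of 3]) (auto simp: cheb_vals)
  next
    case 3
    have "0 < cheb c l" if "0 < l" "l < 4" for l
      using cases[of l] that pos 3 by (auto simp: cheb_vals one simp del: cheb.simps)
    then show thesis using 3 by (intro that[of 4]) (auto simp: cheb_vals)
  next
    case 4
    have "0 < cheb c l" if "0 < l" "l < 6" for l
      using cases[of l] that pos 4 by (auto simp: cheb_vals one simp del: cheb.simps)
    then show thesis using 4 by (intro that[of 6]) (auto simp: cheb_vals)
  qed
qed

subsection \<open>Descent to the dominant chamber\<close>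

lemma weyl_word_scaleR:
  assumes "\<And>i. r i \<noteq> 0"
  shows "weyl_word (\<lambda>i. r i *\<^sub>R \<alpha> i) u = weyl_word \<alpha> u"
  by (rule ext, induction u) (simp_all add: reflection_scaleR assms)

lemma descending_scaleR:
  assumes "\<And>i. 0 < r i"
  shows "descending (\<lambda>i. r i *\<^sub>R \<alpha> i) u v \<longleftrightarrow> descending \<alpha> u v"
proof -
  have "weyl_word (\<lambda>i. r i *\<^sub>R \<alpha> i) u = weyl_word \<alpha> u" for u
    using assms by (intro weyl_word_scaleR) (simp add: less_imp_neq[symmetric])
  moreover have "\<not> r i < 0" for i using assms[of i] by simp
  ultimately show ?thesis
    using assms by (induction u) (auto simp: coroot_scaleR divide_less_0_iff)
qed

lemma pitman_word_scaleR:
  assumes "\<And>i. 0 < r i" "good_path \<eta>" "0 \<le> t"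
  shows "pitman_word (\<lambda>i. r i *\<^sub>R \<alpha> i) u \<eta> t = pitman_word \<alpha> u \<eta> t"
  using assms(3)
proof (induction u arbitrary: t)
  case (Cons i u)
  have "pitman (r i *\<^sub>R \<alpha> i) (pitman_word (\<lambda>i. r i *\<^sub>R \<alpha> i) u \<eta>) t
      = pitman (r i *\<^sub>R \<alpha> i) (pitman_word \<alpha> u \<eta>) t"
    by (rule pitman_cong) (use Cons in auto)
  also have "\<dots> = pitman (\<alpha> i) (pitman_word \<alpha> u \<eta>) t"
    using assms Cons by (intro pitman_scaleR good_pitman_word) auto
  finally show ?case by simp
qed simp

section \<open>Reflections and word length\<close>

lemma reflection_reflection: "b \<noteq> 0 \<Longrightarrow> reflection b (reflection b x) = x"
  by (simp add: reflection_def inner_diff_left coroot_self algebra_simps)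

lemma reflection_uminus: "reflection b (- x) = - reflection b x"
  by (simp add: reflection_def)

lemma inner_reflection_left: "reflection b x \<bullet> y = x \<bullet> reflection b y"
  by (simp add: reflection_def coroot_def inner_diff_left inner_diff_right inner_commute)

text \<open>A reflection is an isometry and carries coroots to coroots. This is the conjugation
  formula for reflections, in the form that moves a reflection past a letter in
  \<open>exchange\<close>.\<close>

lemma reflection_conj:
  assumes "d \<noteq> 0"
  shows "reflection d (reflection (reflection d b) x) = reflection b (reflection d x)"
proof -
  have "reflection d b \<bullet> reflection d b = b \<bullet> b"
    by (simp add: inner_reflection_left reflection_reflection[OF assms])
  then have c: "coroot (reflection d b) = reflection d (coroot b)"
    unfolding coroot_def by (simp only:) (simp add: reflection_def scaleR_diff_right)
  have lin: "reflection d (x - r *\<^sub>R y) = reflection d x - r *\<^sub>R reflection d y" for x y r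
    by (simp add: reflection_def inner_diff_left algebra_simps)
  show ?thesis
    unfolding reflection_def[of "reflection d b"] lin c reflection_reflection[OF assms]
    by (simp add: reflection_def[of b] inner_reflection_left)
qed

lemma weyl_word_uminus: "weyl_word \<alpha> u (- x) = - weyl_word \<alpha> u x"
  by (induction u) (simp_all add: reflection_uminus)

lemma weyl_word_Cons: "weyl_word \<alpha> (i # u) = reflection (\<alpha> i) \<circ> weyl_word \<alpha> u"
  by (simp add: fun_eq_iff)

lemma weyl_length_le: "weyl_length \<alpha> (weyl_word \<alpha> u) \<le> length u"
  unfolding weyl_length_def by (rule Least_le) auto

lemma reduced_word_exists:
  obtains u' where "weyl_word \<alpha> u' = weyl_word \<alpha> u" "length u' = weyl_length \<alpha> (weyl_word \<alpha> u)"
  using LeastI[of "\<lambda>k. \<exists>ws. length ws = k \<and> weyl_word \<alpha> ws = weyl_word \<alpha> u" "length u"]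
  unfolding weyl_length_def by auto

definition regular_dominant :: "('n \<Rightarrow> 'a::euclidean_space) \<Rightarrow> 'a \<Rightarrow> bool" where
  "regular_dominant \<alpha> v \<longleftrightarrow> (\<forall>i. 0 < v \<bullet> coroot (\<alpha> i))"

lemma independent_coefficients:
  fixes \<alpha> :: "'n::finite \<Rightarrow> 'a::real_vector"
  assumes inj: "inj \<alpha>" and "independent (range \<alpha>)"
    and "(\<Sum>i\<in>UNIV. f i *\<^sub>R \<alpha> i) = (\<Sum>i\<in>UNIV. g i *\<^sub>R \<alpha> i)"
  shows "f i = g i"
proof (rule ccontr)
  assume "f i \<noteq> g i"
  have "(\<Sum>v\<in>range \<alpha>. (f (inv \<alpha> v) - g (inv \<alpha> v)) *\<^sub>R v) = (\<Sum>i\<in>UNIV. (f i - g i) *\<^sub>R \<alpha> i)"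
    by (subst sum.reindex[OF inj]) (simp add: inv_f_f[OF inj])
  also have "\<dots> = 0" using assms by (simp add: scaleR_diff_left sum_subtractf)
  finally have "dependent (range \<alpha>)"
    using \<open>f i \<noteq> g i\<close> inv_f_f[OF inj]
    by (subst dependent_finite) (auto intro!: exI[of _ "\<lambda>v. f (inv \<alpha> v) - g (inv \<alpha> v)"] bexI[of _ "\<alpha> i"])
  then show False using assms(2) by simp
qed

text \<open>These are the facts through which the Lie algebra enters. Angles between simple roots,
  length changes and the exchange property are derived from them.\<close>

locale root_basis =
  fixes \<alpha> :: "'n::finite \<Rightarrow> 'a::euclidean_space" and \<Phi> :: "'a set"
  assumes inj: "inj \<alpha>" and independent: "independent (range \<alpha>)"
    and simple_root: "\<alpha> i \<in> \<Phi>"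
    and reflection_root: "\<beta> \<in> \<Phi> \<Longrightarrow> reflection (\<alpha> i) \<beta> \<in> \<Phi>"
    and nonzero_root: "\<beta> \<in> \<Phi> \<Longrightarrow> \<beta> \<noteq> 0"
    and signed_root: "\<beta> \<in> \<Phi> \<Longrightarrow> \<exists>c :: 'n \<Rightarrow> int. \<beta> = (\<Sum>i\<in>UNIV. of_int (c i) *\<^sub>R \<alpha> i) \<and>
      ((\<forall>i. 0 \<le> c i) \<or> (\<forall>i. c i \<le> 0))"
begin

lemma simple_nonzero [simp]: "\<alpha> i \<noteq> 0"
  using nonzero_root[OF simple_root] .

lemmas coefficients_unique = independent_coefficients[OF inj independent]

text \<open>Only the coordinate at \<open>i\<close> moves. Together with \<open>signed_root\<close>
  this lets one untouched nonzero coordinate fix the sign of all the others.\<close>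

lemma reflection_simple_coefficients:
  "reflection (\<alpha> i) (\<Sum>k\<in>UNIV. f k *\<^sub>R \<alpha> k)
    = (\<Sum>k\<in>UNIV. (f k - (if k = i then (\<Sum>k\<in>UNIV. f k *\<^sub>R \<alpha> k) \<bullet> coroot (\<alpha> i) else 0)) *\<^sub>R \<alpha> k)"
proof -
  have "(\<Sum>k\<in>UNIV. (if k = i then x else 0) *\<^sub>R \<alpha> k) = x *\<^sub>R \<alpha> i" for x
    by (simp add: if_distrib[of "\<lambda>x. x *\<^sub>R _"] cong: if_cong)
  then show ?thesis by (simp add: reflection_def scaleR_diff_left sum_subtractf)
qed

lemma simple_coefficients: "\<alpha> j = (\<Sum>k\<in>UNIV. (if k = j then 1 else 0) *\<^sub>R \<alpha> k)"
  by (simp add: if_distrib[of "\<lambda>x. x *\<^sub>R _"] cong: if_cong)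

text \<open>The coordinate at \<open>j\<close> of the reflected root is still 1, so no coordinate is
  negative; the one at \<open>i\<close> is minus the pairing.\<close>

lemma cartan_integer:
  assumes "i \<noteq> j"
  obtains a :: int where "a \<le> 0" "\<alpha> j \<bullet> coroot (\<alpha> i) = of_int a"
proof -
  obtain c :: "'n \<Rightarrow> int" where c: "reflection (\<alpha> i) (\<alpha> j) = (\<Sum>i\<in>UNIV. of_int (c i) *\<^sub>R \<alpha> i)"
    "(\<forall>i. 0 \<le> c i) \<or> (\<forall>i. c i \<le> 0)"
    using signed_root[OF reflection_root[OF simple_root]] by blast
  have "reflection (\<alpha> i) (\<alpha> j)
      = (\<Sum>k\<in>UNIV. ((if k = j then 1 else 0) - (if k = i then \<alpha> j \<bullet> coroot (\<alpha> i) else 0)) *\<^sub>R \<alpha> k)"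
    using reflection_simple_coefficients[of i "\<lambda>k. if k = j then 1 else 0"]
    unfolding simple_coefficients[of j, symmetric] .
  note coeff = coefficients_unique[OF this[unfolded c(1)]]
  have "of_int (c j) = (1::real)" "of_int (c i) = - (\<alpha> j \<bullet> coroot (\<alpha> i))"
    using coeff[of j] coeff[of i] assms by auto
  then have "0 \<le> c i" "\<alpha> j \<bullet> coroot (\<alpha> i) = of_int (- c i)" using c(2) by (auto dest: spec[of _ j])
  then show thesis by (intro that[of "- c i"]) auto
qed

text \<open>The square is the product of the two Cartan integers, both nonpositive; it is below 4 by
  the strict Cauchy-Schwarz inequality.\<close>

lemma simple_angle:
  assumes "i \<noteq> j"
  shows "\<alpha> i \<bullet> \<alpha> j \<le> 0"
    and "(2 * (\<alpha> i \<bullet> \<alpha> j) / (norm (\<alpha> i) * norm (\<alpha> j)))\<^sup>2 \<in> {0, 1, 2, 3}" (is "?c \<in> _")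
proof -
  obtain a b :: int where ab: "a \<le> 0" "b \<le> 0" "\<alpha> j \<bullet> coroot (\<alpha> i) = of_int a"
    "\<alpha> i \<bullet> coroot (\<alpha> j) = of_int b"
    using cartan_integer[OF assms] cartan_integer[OF assms[symmetric]] by metis
  have *: "\<alpha> j \<bullet> coroot (\<alpha> i) = 2 * (\<alpha> i \<bullet> \<alpha> j) / (norm (\<alpha> i))\<^sup>2"
    "\<alpha> i \<bullet> coroot (\<alpha> j) = 2 * (\<alpha> i \<bullet> \<alpha> j) / (norm (\<alpha> j))\<^sup>2"
    by (simp_all add: coroot_def power2_norm_eq_inner inner_commute)
  then have "2 * (\<alpha> i \<bullet> \<alpha> j) = of_int a * (norm (\<alpha> i))\<^sup>2" using ab by (simp add: field_simps)
  also have "\<dots> \<le> 0" using ab by (intro mult_nonpos_nonneg) auto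
  finally show "\<alpha> i \<bullet> \<alpha> j \<le> 0" by simp
  have c: "?c = of_int (a * b)"
    using * ab by (simp add: power2_eq_square field_simps)
  \<comment> \<open>Equality would make two distinct simple roots parallel, against
    independence.\<close>
  have "\<bar>\<alpha> i \<bullet> \<alpha> j\<bar> \<noteq> norm (\<alpha> i) * norm (\<alpha> j)"
  proof
    assume "\<bar>\<alpha> i \<bullet> \<alpha> j\<bar> = norm (\<alpha> i) * norm (\<alpha> j)"
    then obtain r where r: "r \<noteq> 0" "norm (\<alpha> i) *\<^sub>R \<alpha> j = r *\<^sub>R \<alpha> i"
      unfolding norm_cauchy_schwarz_abs_eq
      by (metis add.inverse_neutral norm_eq_zero scaleR_minus_left simple_nonzero equation_minus_iff)
    then have "(\<Sum>k\<in>UNIV. (if k = j then norm (\<alpha> i) else 0) *\<^sub>R \<alpha> k)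
        = (\<Sum>k\<in>UNIV. (if k = i then r else 0) *\<^sub>R \<alpha> k)"
      by (simp add: if_distrib[of "\<lambda>x. x *\<^sub>R _"] cong: if_cong)
    from coefficients_unique[OF this, of i] show False using assms r by auto
  qed
  then have "\<bar>\<alpha> i \<bullet> \<alpha> j\<bar> < norm (\<alpha> i) * norm (\<alpha> j)"
    using Cauchy_Schwarz_ineq2[of "\<alpha> i" "\<alpha> j"] by simp
  then have "\<bar>2 * (\<alpha> i \<bullet> \<alpha> j) / (norm (\<alpha> i) * norm (\<alpha> j))\<bar> < 2"
    by (simp add: divide_simps abs_mult)
  from power_strict_mono[OF this abs_ge_zero, of 2] have "?c < 2\<^sup>2" by (simp only: power2_abs)
  then have "?c < 4" by simp
  then have "real_of_int (a * b) < real_of_int 4" using c by simp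
  then have "a * b < 4" by (simp only: of_int_less_iff)
  moreover have "0 \<le> a * b" using ab by (simp add: mult_nonpos_nonpos)
  moreover have "x \<in> {0, 1, 2, 3}" if "x < 4" "0 \<le> x" for x :: int
    using that unfolding insert_iff empty_iff by presburger
  ultimately have "real_of_int (a * b) \<in> real_of_int ` {0, 1, 2, 3}" by blast
  then show "?c \<in> {0, 1, 2, 3}" unfolding c by (simp del: of_int_mult)
qed

text \<open>The local diamond for confluence: descents that begin with different letters
  \<open>i\<close> and \<open>j\<close> can be continued to meet, with the same effect on vectors
  and on paths.\<close>

lemma braid_pair:
  assumes "i \<noteq> j" and neg: "v \<bullet> coroot (\<alpha> i) < 0" "v \<bullet> coroot (\<alpha> j) < 0"
  obtains u\<^sub>1 u\<^sub>2 where "descending \<alpha> (u\<^sub>1 @ [i]) v" "descending \<alpha> (u\<^sub>2 @ [j]) v"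
    "weyl_word \<alpha> (u\<^sub>1 @ [i]) v = weyl_word \<alpha> (u\<^sub>2 @ [j]) v"
    "\<And>\<eta> t. good_path \<eta> \<Longrightarrow> 0 \<le> t \<Longrightarrow> pitman_word \<alpha> (u\<^sub>1 @ [i]) \<eta> t = pitman_word \<alpha> (u\<^sub>2 @ [j]) \<eta> t"
proof -
  define r where "r k = inverse (norm (\<alpha> k))" for k
  define \<alpha>' where "\<alpha>' = (\<lambda>k. r k *\<^sub>R \<alpha> k)"
  define c where "c = - (2 * (\<alpha> i \<bullet> \<alpha> j) / (norm (\<alpha> i) * norm (\<alpha> j)))"
  have r: "0 < r k" for k by (simp add: r_def)
  have nz: "\<alpha>' k \<noteq> 0" for k using r[of k] by (simp add: \<alpha>'_def)
  have "\<alpha>' k \<bullet> \<alpha>' k = 1" for k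
    by (simp add: \<alpha>'_def r_def power2_norm_eq_inner[symmetric] power2_eq_square)
  then have coroot: "coroot (\<alpha>' k) = 2 *\<^sub>R \<alpha>' k" for k by (simp add: coroot_def)
  have c: "\<alpha>' i \<bullet> coroot (\<alpha>' j) = - c" "\<alpha>' j \<bullet> coroot (\<alpha>' i) = - c"
    unfolding coroot by (simp_all add: \<alpha>'_def r_def c_def field_simps inner_commute)
  have "0 \<le> c" "c\<^sup>2 \<in> {0, 1, 2, 3}"
    using simple_angle[OF assms(1)] by (auto simp: c_def divide_nonpos_nonneg)
  then obtain m where m: "2 \<le> m" and cheb: "\<And>l. 0 < l \<Longrightarrow> l < m \<Longrightarrow> 0 < cheb c l" "cheb c m = 0"
    using braid_order_exists by blast
  have neg': "v \<bullet> coroot (\<alpha>' i) < 0" "v \<bullet> coroot (\<alpha>' j) < 0"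
    using neg r by (simp_all add: \<alpha>'_def coroot_scaleR divide_less_0_iff)
  have desc: "descending \<alpha>' (alt_word i j m) v" "descending \<alpha>' (alt_word j i m) v"
    using descending_alt_word[of \<alpha>' i j c m v, OF nz[of i] nz[of j] c cheb neg']
      descending_alt_word[of \<alpha>' j i c m v, OF nz[of j] nz[of i] c(2,1) cheb neg'(2,1)]
    by auto
  have pit: "pitman_word \<alpha>' (alt_word i j m) \<eta> t = pitman_word \<alpha>' (alt_word j i m) \<eta> t"
    if "good_path \<eta>" "0 \<le> t" for \<eta> t
    using pitman_braid_normalized[of \<alpha>' i j c m \<eta> t, OF nz[of i] nz[of j] c cheb that] .
  \<comment> \<open>Evaluating the path identity on the line through \<open>v\<close> at time 1
    yields the braid relation of the reflections at \<open>v\<close>.\<close>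
  have "good_path (\<lambda>t. t *\<^sub>R v)" by (auto simp: good_path_def intro!: continuous_intros)
  from pit[OF this, of 1] have "weyl_word \<alpha>' (alt_word i j m) v = weyl_word \<alpha>' (alt_word j i m) v"
    using pitman_word_line[OF desc(1), of 1] pitman_word_line[OF desc(2), of 1] by simp
  note weyl = this
  have r_nz: "r k \<noteq> 0" for k using r[of k] by simp
  have facts: "descending \<alpha> (alt_word i j m) v" "descending \<alpha> (alt_word j i m) v"
    "weyl_word \<alpha> (alt_word i j m) v = weyl_word \<alpha> (alt_word j i m) v"
    "\<And>\<eta> t. good_path \<eta> \<Longrightarrow> 0 \<le> t \<Longrightarrow>
      pitman_word \<alpha> (alt_word i j m) \<eta> t = pitman_word \<alpha> (alt_word j i m) \<eta> t"
    subgoal using desc(1) unfolding \<alpha>'_def descending_scaleR[of r, OF r] .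
    subgoal using desc(2) unfolding \<alpha>'_def descending_scaleR[of r, OF r] .
    subgoal using weyl unfolding \<alpha>'_def weyl_word_scaleR[of r, OF r_nz] .
    subgoal for \<eta> t using pit[of \<eta> t] pitman_word_scaleR[of r \<eta> t, OF r] unfolding \<alpha>'_def by simp
    done
  obtain k where k: "m = Suc k" using m by (cases m) auto
  \<comment> \<open>Which of the two alternating words ends in \<open>i\<close> depends on the
    parity of their length.\<close>
  show thesis
  proof (cases "even k")
    case True
    then show thesis
      using that[of "alt_word i j k" "alt_word j i k"] facts unfolding k alt_word_snoc by auto
  next
    case False
    then show thesis
      using that[of "alt_word j i k" "alt_word i j k"] facts unfolding k alt_word_snoc by auto
  qed
qed

section \<open>Regular orbits, exchange and length\<close>

lemma weyl_word_rev: "weyl_word \<alpha> (rev u) (weyl_word \<alpha> u x) = x"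
  by (induction u arbitrary: x) (simp_all add: reflection_reflection)

lemma inner_weyl_word: "weyl_word \<alpha> u x \<bullet> y = x \<bullet> weyl_word \<alpha> (rev u) y"
  by (induction u arbitrary: y) (simp_all add: inner_reflection_left)

lemma weyl_word_root: "\<beta> \<in> \<Phi> \<Longrightarrow> weyl_word \<alpha> u \<beta> \<in> \<Phi>"
  by (induction u) (auto intro: reflection_root)

lemma simple_inner_sign:
  "v \<bullet> \<alpha> i < 0 \<longleftrightarrow> v \<bullet> coroot (\<alpha> i) < 0" "0 < v \<bullet> \<alpha> i \<longleftrightarrow> 0 < v \<bullet> coroot (\<alpha> i)"
  using inner_gt_zero_iff[of "\<alpha> i"]
  by (simp_all add: coroot_def divide_less_0_iff zero_less_divide_iff del: inner_gt_zero_iff)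

lemma regular_root:
  assumes m: "regular_dominant \<alpha> m" and "\<beta> \<in> \<Phi>"
  shows "m \<bullet> \<beta> \<noteq> 0"
proof -
  obtain c :: "'n \<Rightarrow> int" where c: "\<beta> = (\<Sum>i\<in>UNIV. of_int (c i) *\<^sub>R \<alpha> i)"
    "(\<forall>i. 0 \<le> c i) \<or> (\<forall>i. c i \<le> 0)"
    using signed_root[OF assms(2)] by blast
  have "\<exists>k. c k \<noteq> 0"
  proof (rule ccontr)
    assume "\<not> ?thesis"
    then have "\<beta> = 0" by (simp add: c(1))
    then show False using nonzero_root[OF assms(2)] by simp
  qed
  then obtain k where k: "c k \<noteq> 0" ..
  have pos: "0 < m \<bullet> \<alpha> i" for i using m simple_inner_sign(2) by (simp add: regular_dominant_def)
  have eq: "m \<bullet> \<beta> = (\<Sum>i\<in>UNIV. of_int (c i) * (m \<bullet> \<alpha> i))" by (simp add: c(1) inner_sum_right)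
  from c(2) show ?thesis
  proof
    assume *: "\<forall>i. 0 \<le> c i"
    have "0 < (\<Sum>i\<in>UNIV. of_int (c i) * (m \<bullet> \<alpha> i))"
      using * k pos by (intro sum_pos2[of _ k]) (auto simp: less_le intro!: mult_nonneg_nonneg)
    then show ?thesis using eq by simp
  next
    assume *: "\<forall>i. c i \<le> 0"
    have "0 < (\<Sum>i\<in>UNIV. - of_int (c i) * (m \<bullet> \<alpha> i))"
      using * k pos by (intro sum_pos2[of _ k]) (auto simp: less_le mult_le_0_iff mult_less_0_iff)
    then show ?thesis using eq by (simp add: sum_negf)
  qed
qed

text \<open>The orbit of a regular dominant vector avoids all simple walls, so a pairing that is not
  positive is negative.\<close>

lemma regular_weyl_word:
  assumes "regular_dominant \<alpha> m"
  shows "weyl_word \<alpha> u m \<bullet> coroot (\<alpha> i) \<noteq> 0"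
  using regular_root[OF assms weyl_word_root[OF simple_root[of i], of "rev u"]]
  by (simp add: coroot_def inner_weyl_word)

text \<open>Follow the root through the word: at the letter where it turns negative it is proportional
  to the simple root of that letter, which can then be deleted.\<close>

lemma exchange:
  fixes c :: "'n \<Rightarrow> int"
  assumes m: "regular_dominant \<alpha> m"
    and "\<beta> \<in> \<Phi>" "\<beta> = (\<Sum>i\<in>UNIV. of_int (c i) *\<^sub>R \<alpha> i)" "\<And>i. 0 \<le> c i"
    and "weyl_word \<alpha> u m \<bullet> \<beta> < 0"
  shows "\<exists>u'. length u' < length u \<and> weyl_word \<alpha> u' = reflection \<beta> \<circ> weyl_word \<alpha> u"
  using assms(2-)
proof (induction u arbitrary: \<beta> c)
  case Nil
  have "0 \<le> of_int (c i) * (m \<bullet> \<alpha> i)" for i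
    using m Nil.prems(3)[of i] simple_inner_sign(2)[of m i]
    by (intro mult_nonneg_nonneg) (auto simp: regular_dominant_def less_imp_le)
  then have "0 \<le> m \<bullet> \<beta>" unfolding Nil.prems(2) by (simp add: inner_sum_right sum_nonneg)
  then show ?case using Nil.prems(4) by simp
next
  case (Cons j u)
  let ?\<gamma> = "reflection (\<alpha> j) \<beta>"
  have \<gamma>: "?\<gamma> \<in> \<Phi>" using Cons.prems(1) by (rule reflection_root)
  then obtain d :: "'n \<Rightarrow> int" where d: "?\<gamma> = (\<Sum>i\<in>UNIV. of_int (d i) *\<^sub>R \<alpha> i)"
    "(\<forall>i. 0 \<le> d i) \<or> (\<forall>i. d i \<le> 0)"
    using signed_root by blast
  from d(2) show ?case
  proof
    assume "\<forall>i. 0 \<le> d i"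
    moreover have "weyl_word \<alpha> u m \<bullet> ?\<gamma> < 0"
      using Cons.prems(4) by (simp add: inner_reflection_left)
    ultimately have "\<exists>u'. length u' < length u \<and> weyl_word \<alpha> u' = reflection ?\<gamma> \<circ> weyl_word \<alpha> u"
      by (intro Cons.IH[OF \<gamma> d(1)]) auto
    then obtain u' where "length u' < length u" "weyl_word \<alpha> u' = reflection ?\<gamma> \<circ> weyl_word \<alpha> u"
      by blast
    then show ?thesis
      by (intro exI[of _ "j # u'"]) (auto simp: fun_eq_iff reflection_conj)
  next
    assume d': "\<forall>i. d i \<le> 0"
    \<comment> \<open>Coordinates other than the one at \<open>j\<close> are unchanged, hence both
      nonnegative and nonpositive, hence zero.\<close>
    have "(\<Sum>i\<in>UNIV. of_int (d i) *\<^sub>R \<alpha> i)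
        = (\<Sum>k\<in>UNIV. (of_int (c k) - (if k = j then \<beta> \<bullet> coroot (\<alpha> j) else 0)) *\<^sub>R \<alpha> k)"
      using reflection_simple_coefficients[of j "\<lambda>k. of_int (c k)"]
      unfolding Cons.prems(2)[symmetric] d(1) .
    from coefficients_unique[OF this] have "(of_int (d k) :: real) = of_int (c k)" if "k \<noteq> j" for k
      using that by (metis diff_zero)
    then have "c k = 0" if "k \<noteq> j" for k
      using that d' Cons.prems(3)[of k] by (metis antisym of_int_eq_iff)
    then have "\<beta> = (\<Sum>k\<in>UNIV. (if k = j then of_int (c j) else 0) *\<^sub>R \<alpha> k)"
      unfolding Cons.prems(2) by (intro sum.cong) auto
    then have \<beta>: "\<beta> = of_int (c j) *\<^sub>R \<alpha> j"
      by (simp add: if_distrib[of "\<lambda>x. x *\<^sub>R _"] cong: if_cong)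
    then have "of_int (c j) \<noteq> (0::real)" using nonzero_root[OF Cons.prems(1)] by auto
    then have "reflection \<beta> = reflection (\<alpha> j)" unfolding \<beta> by (rule reflection_scaleR)
    then show ?thesis
      by (intro exI[of _ u]) (auto simp: fun_eq_iff reflection_reflection)
  qed
qed

text \<open>\<open>exchange\<close> for the simple root at \<open>j\<close>, applied to a reduced
  word since \<open>u\<close> may not be one.\<close>

lemma weyl_length_descent:
  assumes m: "regular_dominant \<alpha> m" and neg: "weyl_word \<alpha> u m \<bullet> coroot (\<alpha> j) < 0"
  shows "weyl_length \<alpha> (weyl_word \<alpha> (j # u)) < weyl_length \<alpha> (weyl_word \<alpha> u)"
proof -
  obtain u' where u': "weyl_word \<alpha> u' = weyl_word \<alpha> u" "length u' = weyl_length \<alpha> (weyl_word \<alpha> u)"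
    using reduced_word_exists .
  have "\<alpha> j = (\<Sum>i\<in>UNIV. of_int (if i = j then 1 else 0) *\<^sub>R \<alpha> i)"
    by (subst simple_coefficients) (rule sum.cong, auto)
  moreover have "weyl_word \<alpha> u' m \<bullet> \<alpha> j < 0" using neg u' simple_inner_sign by simp
  ultimately have "\<exists>u''. length u'' < length u' \<and> weyl_word \<alpha> u'' = reflection (\<alpha> j) \<circ> weyl_word \<alpha> u'"
    by (intro exchange[OF m simple_root]) auto
  then obtain u'' where "length u'' < length u'"
    "weyl_word \<alpha> u'' = reflection (\<alpha> j) \<circ> weyl_word \<alpha> u'" by blast
  then show ?thesis
    using u' weyl_length_le[of \<alpha> u''] unfolding weyl_word_Cons by simp
qed

lemma weyl_length_ascent:
  assumes m: "regular_dominant \<alpha> m" and pos: "0 < weyl_word \<alpha> u m \<bullet> coroot (\<alpha> j)"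
  shows "weyl_length \<alpha> (weyl_word \<alpha> u) < weyl_length \<alpha> (weyl_word \<alpha> (j # u))"
proof -
  have "weyl_word \<alpha> (j # u) m \<bullet> coroot (\<alpha> j) < 0"
    using pos by (simp add: reflection_def inner_diff_left coroot_self)
  moreover have "weyl_word \<alpha> (j # j # u) = weyl_word \<alpha> u"
    by (auto simp: fun_eq_iff reflection_reflection)
  ultimately show ?thesis using weyl_length_descent[OF m, of "j # u" j] by simp
qed

text \<open>By \<open>weyl_length_descent\<close>, a letter that lengthens the element finds the
  image of \<open>m\<close> on the positive side of its wall, and therefore that of
  \<open>- m\<close> on the negative side.\<close>

lemma descending_reduced:
  assumes m: "regular_dominant \<alpha> m" and "length u = weyl_length \<alpha> (weyl_word \<alpha> u)"
  shows "descending \<alpha> u (- m)"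
  using assms(2)
proof (induction u)
  case (Cons j u)
  obtain u' where u': "weyl_word \<alpha> u' = weyl_word \<alpha> u" "length u' = weyl_length \<alpha> (weyl_word \<alpha> u)"
    using reduced_word_exists .
  \<comment> \<open>A letter adds at most one to the length, so the tail of a reduced word is
    reduced.\<close>
  have "weyl_length \<alpha> (weyl_word \<alpha> (j # u)) \<le> Suc (length u')"
    using weyl_length_le[of \<alpha> "j # u'"] u' unfolding weyl_word_Cons by simp
  then have u: "length u = weyl_length \<alpha> (weyl_word \<alpha> u)"
    using Cons.prems u' weyl_length_le[of \<alpha> u] by (simp del: weyl_word_simps)
  have "\<not> weyl_word \<alpha> u m \<bullet> coroot (\<alpha> j) < 0"
    using weyl_length_descent[OF m, of u j] Cons.prems u by (auto simp del: weyl_word_simps)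
  then show ?case
    using Cons.IH[OF u] regular_weyl_word[OF m, of u j] by (simp add: weyl_word_uminus)
qed simp

text \<open>For \<open>m\<close> itself the word crosses every wall from the positive to the
  negative side; undoing the letters crosses back.\<close>

lemma descending_rev:
  assumes "descending \<alpha> u (- m)"
  shows "descending \<alpha> (rev u) (weyl_word \<alpha> u m)"
  using assms
  by (induction u)
    (simp_all add: weyl_word_uminus reflection_reflection inner_diff_left coroot_self,
     simp add: reflection_def inner_diff_left coroot_self)

text \<open>Crossing any wall with negative pairing shortens the element, so the procedure stops,
  and it can stop only in the open dominant chamber.\<close>

lemma descending_completion:
  assumes m: "regular_dominant \<alpha> m"
  shows "\<exists>u'. descending \<alpha> u' (weyl_word \<alpha> u m) \<and>
    regular_dominant \<alpha> (weyl_word \<alpha> u' (weyl_word \<alpha> u m))"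
proof (induction "weyl_length \<alpha> (weyl_word \<alpha> u)" arbitrary: u rule: less_induct)
  case less
  show ?case
  proof (cases "regular_dominant \<alpha> (weyl_word \<alpha> u m)")
    case True
    then show ?thesis by (intro exI[of _ "[]"]) simp
  next
    case False
    then obtain j where "\<not> 0 < weyl_word \<alpha> u m \<bullet> coroot (\<alpha> j)"
      unfolding regular_dominant_def by blast
    then have j: "weyl_word \<alpha> u m \<bullet> coroot (\<alpha> j) < 0"
      using regular_weyl_word[OF m, of u j] by simp
    obtain u' where "descending \<alpha> u' (weyl_word \<alpha> (j # u) m)"
      "regular_dominant \<alpha> (weyl_word \<alpha> u' (weyl_word \<alpha> (j # u) m))"
      using less[OF weyl_length_descent[OF m j]] by blast
    then show ?thesis using j by (intro exI[of _ "u' @ [j]"]) simp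
  qed
qed

text \<open>Newman's lemma for the descent to the dominant chamber, the local confluence being the braid
  relation. This replaces Matsumoto's theorem on reduced words.\<close>

lemma pitman_word_confluent:
  assumes m: "regular_dominant \<alpha> m"
    and "descending \<alpha> u\<^sub>1 (weyl_word \<alpha> u m)" "regular_dominant \<alpha> (weyl_word \<alpha> u\<^sub>1 (weyl_word \<alpha> u m))"
    and "descending \<alpha> u\<^sub>2 (weyl_word \<alpha> u m)" "regular_dominant \<alpha> (weyl_word \<alpha> u\<^sub>2 (weyl_word \<alpha> u m))"
    and "good_path \<eta>" "0 \<le> t"
  shows "pitman_word \<alpha> u\<^sub>1 \<eta> t = pitman_word \<alpha> u\<^sub>2 \<eta> t"
  using assms(2-)
proof (induction "weyl_length \<alpha> (weyl_word \<alpha> u)" arbitrary: u u\<^sub>1 u\<^sub>2 \<eta> t rule: less_induct)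
  case less
  define v where "v = weyl_word \<alpha> u m"
  \<comment> \<open>Regular dominant vectors are the normal forms: no letter can act first on
    them.\<close>
  have dom: "u' = []" if "regular_dominant \<alpha> v" "descending \<alpha> u' v" for u'
    using that by (cases u' rule: rev_cases) (auto simp: regular_dominant_def dest: spec[of _ "last u'"])
  show ?case
  proof (cases "u\<^sub>1 = [] \<or> u\<^sub>2 = []")
    case True
    then have "regular_dominant \<alpha> v" using less.prems by (auto simp: v_def)
    then have "u\<^sub>1 = []" "u\<^sub>2 = []" using dom less.prems by (auto simp: v_def)
    then show ?thesis by simp
  next
    case False
    then obtain w\<^sub>1 w\<^sub>2 i j where w: "u\<^sub>1 = w\<^sub>1 @ [i]" "u\<^sub>2 = w\<^sub>2 @ [j]"
      by (metis rev_exhaust)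
    have i: "v \<bullet> coroot (\<alpha> i) < 0" and j: "v \<bullet> coroot (\<alpha> j) < 0"
      using less.prems by (auto simp: v_def w)
    have IH: "pitman_word \<alpha> w\<^sub>1 (pitman (\<alpha> k) \<eta>) t = pitman_word \<alpha> w\<^sub>2 (pitman (\<alpha> k) \<eta>) t"
      if "v \<bullet> coroot (\<alpha> k) < 0"
        "descending \<alpha> (w\<^sub>1 @ [k]) v" "regular_dominant \<alpha> (weyl_word \<alpha> (w\<^sub>1 @ [k]) v)"
        "descending \<alpha> (w\<^sub>2 @ [k]) v" "regular_dominant \<alpha> (weyl_word \<alpha> (w\<^sub>2 @ [k]) v)" for k w\<^sub>1 w\<^sub>2
      using that weyl_length_descent[OF m, of u k] less.prems
      by (intro less.hyps[of "k # u"]) (auto simp: v_def intro: good_pitman)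
    show ?thesis
    proof (cases "i = j")
      case True
      then show ?thesis using IH[OF i, of w\<^sub>1 w\<^sub>2] less.prems by (simp add: w v_def)
    next
      case False
      obtain b\<^sub>1 b\<^sub>2 where b: "descending \<alpha> (b\<^sub>1 @ [i]) v" "descending \<alpha> (b\<^sub>2 @ [j]) v"
        "weyl_word \<alpha> (b\<^sub>1 @ [i]) v = weyl_word \<alpha> (b\<^sub>2 @ [j]) v"
        "\<And>\<eta> t. good_path \<eta> \<Longrightarrow> 0 \<le> t \<Longrightarrow> pitman_word \<alpha> (b\<^sub>1 @ [i]) \<eta> t = pitman_word \<alpha> (b\<^sub>2 @ [j]) \<eta> t"
        using braid_pair[OF False i j] by blast
      \<comment> \<open>Both sides of the diamond are continued by the same \<open>d\<close>. Each
        becomes a complete descent beginning with \<open>i\<close> or with \<open>j\<close>, so the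
        induction hypothesis compares it with the given word.\<close>
      obtain d where d: "descending \<alpha> d (weyl_word \<alpha> (b\<^sub>1 @ [i]) v)"
        "regular_dominant \<alpha> (weyl_word \<alpha> d (weyl_word \<alpha> (b\<^sub>1 @ [i]) v))"
        using descending_completion[OF m, of "(b\<^sub>1 @ [i]) @ u"] unfolding v_def weyl_word_simps by blast
      have "pitman_word \<alpha> u\<^sub>1 \<eta> t = pitman_word \<alpha> (d @ b\<^sub>1 @ [i]) \<eta> t"
        using IH[OF i, of w\<^sub>1 "d @ b\<^sub>1"] less.prems b(1) d by (simp add: w v_def)
      also have "\<dots> = pitman_word \<alpha> (d @ b\<^sub>2 @ [j]) \<eta> t"
        using pitman_word_cong[of "pitman_word \<alpha> (b\<^sub>1 @ [i]) \<eta>" "pitman_word \<alpha> (b\<^sub>2 @ [j]) \<eta>" t \<alpha> d]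
          b(4) less.prems by simp
      also have "\<dots> = pitman_word \<alpha> u\<^sub>2 \<eta> t"
        using IH[OF j, of "d @ b\<^sub>2" w\<^sub>2] less.prems b(2) d unfolding b(3) by (simp add: w v_def)
      finally show ?thesis .
    qed
  qed
qed

text \<open>Otherwise the pairing is positive by regularity, and the letter \<open>i\<close> would
  produce a longer element.\<close>

lemma longest_antidominant:
  assumes m: "regular_dominant \<alpha> m" and "longest_element \<alpha> w\<^sub>0"
  shows "w\<^sub>0 m \<bullet> coroot (\<alpha> i) < 0"
proof (rule ccontr)
  assume *: "\<not> ?thesis"
  obtain u where u: "w\<^sub>0 = weyl_word \<alpha> u"
    using assms(2) by (auto simp: longest_element_def weyl_group_def)
  then have "0 < weyl_word \<alpha> u m \<bullet> coroot (\<alpha> i)"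
    using * regular_weyl_word[OF m, of u i] by simp
  then have "weyl_length \<alpha> w\<^sub>0 < weyl_length \<alpha> (weyl_word \<alpha> (i # u))"
    using weyl_length_ascent[OF m] u by simp
  then show False using assms(2) unfolding longest_element_def weyl_group_def by (meson leD rangeI)
qed

text \<open>The reverse of \<open>ws\<close> undoes the longest element. For \<open>ws\<close>
  itself, \<open>- w\<^sub>0 m\<close> is again regular dominant and takes the place of
  \<open>m\<close>; this avoids showing that the longest element is an involution.\<close>

lemma longest_word_descents:
  assumes m: "regular_dominant \<alpha> m" and w\<^sub>0: "longest_element \<alpha> w\<^sub>0" "reduced_decomposition \<alpha> w\<^sub>0 ws"
  shows "descending \<alpha> ws (- m)"
    and "descending \<alpha> (rev ws) (w\<^sub>0 m)" "regular_dominant \<alpha> (weyl_word \<alpha> (rev ws) (w\<^sub>0 m))"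
    and "descending \<alpha> ws (w\<^sub>0 m)" "regular_dominant \<alpha> (weyl_word \<alpha> ws (w\<^sub>0 m))"
proof -
  have ws: "w\<^sub>0 = weyl_word \<alpha> ws" "length ws = weyl_length \<alpha> (weyl_word \<alpha> ws)"
    using w\<^sub>0(2) by (auto simp: reduced_decomposition_def)
  have m': "regular_dominant \<alpha> (- w\<^sub>0 m)"
    using longest_antidominant[OF m w\<^sub>0(1)] by (simp add: regular_dominant_def)
  show *: "descending \<alpha> ws (- m)" by (rule descending_reduced[OF m ws(2)])
  then show "descending \<alpha> (rev ws) (w\<^sub>0 m)" unfolding ws(1) by (rule descending_rev)
  show "regular_dominant \<alpha> (weyl_word \<alpha> (rev ws) (w\<^sub>0 m))" using m by (simp add: ws(1) weyl_word_rev)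
  show "descending \<alpha> ws (w\<^sub>0 m)" using descending_reduced[OF m' ws(2)] by simp
  have "w\<^sub>0 (- w\<^sub>0 m) = - w\<^sub>0 (w\<^sub>0 m)" by (simp add: ws(1) weyl_word_uminus)
  then show "regular_dominant \<alpha> (weyl_word \<alpha> ws (w\<^sub>0 m))"
    using longest_antidominant[OF m' w\<^sub>0(1)] by (simp add: regular_dominant_def ws(1)[symmetric])
qed

text \<open>At an antidominant vector every letter is a legitimate first step. Completing the
  descent and using confluence yields a word for \<open>P\<close> in which \<open>j\<close> acts
  first.\<close>

lemma pitman_longest_last_letter:
  assumes m: "regular_dominant \<alpha> m" and w\<^sub>0: "longest_element \<alpha> w\<^sub>0" "reduced_decomposition \<alpha> w\<^sub>0 ws"
  obtains u where "\<And>\<eta> t. good_path \<eta> \<Longrightarrow> 0 \<le> t \<Longrightarrow>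
    pitman_word \<alpha> ws \<eta> t = pitman_word \<alpha> u (pitman (\<alpha> j) \<eta>) t"
proof -
  have ws: "w\<^sub>0 = weyl_word \<alpha> ws" using w\<^sub>0(2) by (auto simp: reduced_decomposition_def)
  obtain u where "descending \<alpha> u (weyl_word \<alpha> (j # ws) m)"
    "regular_dominant \<alpha> (weyl_word \<alpha> u (weyl_word \<alpha> (j # ws) m))"
    using descending_completion[OF m] by blast
  then have u: "descending \<alpha> (u @ [j]) (weyl_word \<alpha> ws m)"
    "regular_dominant \<alpha> (weyl_word \<alpha> (u @ [j]) (weyl_word \<alpha> ws m))"
    using longest_antidominant[OF m w\<^sub>0(1), of j] ws by auto
  show thesis
    using that[of u] pitman_word_confluent[OF m longest_word_descents(4,5)[OF m w\<^sub>0, unfolded ws] u]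
    by simp
qed

lemma pitman_longest_rev:
  assumes "regular_dominant \<alpha> m" "longest_element \<alpha> w\<^sub>0" "reduced_decomposition \<alpha> w\<^sub>0 ws"
    and "good_path \<eta>" "0 \<le> t"
  shows "pitman_word \<alpha> ws \<eta> t = pitman_word \<alpha> (rev ws) \<eta> t"
proof -
  have ws: "w\<^sub>0 = weyl_word \<alpha> ws" using assms(3) by (auto simp: reduced_decomposition_def)
  show ?thesis
    using longest_word_descents(2-5)[OF assms(1-3)] assms(4,5)
    unfolding ws by (intro pitman_word_confluent[OF assms(1)])
qed

end

subsection \<open>Inverting the transforms\<close>

text \<open>The real-time counterpart of \<open>has_mean\<close>: the transforms take infima over
  all times, so the limit is propagated along the reals.\<close>

definition has_drift :: "('n \<Rightarrow> 'a::euclidean_space) \<Rightarrow> 'a \<Rightarrow> (real \<Rightarrow> 'a) \<Rightarrow> bool" where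
  "has_drift \<alpha> v \<eta> \<longleftrightarrow> (\<forall>i. ((\<lambda>t. (\<eta> t \<bullet> coroot (\<alpha> i)) / t) \<longlongrightarrow> v \<bullet> coroot (\<alpha> i)) at_top)"

lemma slope_at_top:
  assumes "((\<lambda>t. h t / t) \<longlongrightarrow> p) at_top" "0 < (p::real)"
  shows "filterlim h at_top at_top"
proof -
  have "filterlim (\<lambda>t. h t / t * t) at_top at_top"
    by (rule filterlim_tendsto_pos_mult_at_top[OF assms filterlim_ident])
  moreover have "eventually (\<lambda>t. h t / t * t = h t) at_top"
    using eventually_gt_at_top[of "0::real"] by eventually_elim simp
  ultimately show ?thesis by (simp cong: filterlim_cong)
qed

lemma slope_at_bot:
  assumes "((\<lambda>t. h t / t) \<longlongrightarrow> p) at_top" "(p::real) < 0"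
  shows "filterlim h at_bot at_top"
  using slope_at_top[of "\<lambda>t. - h t" "- p"] tendsto_minus[OF assms(1)] assms(2)
  by (simp add: filterlim_uminus_at_bot)

text \<open>A minimiser on \<open>{0..t}\<close> lies either before a fixed time, where its value is
  negligible against \<open>t\<close>, or after it, where the linear lower bound with negative slope
  is smallest at \<open>t\<close>.\<close>

lemma past_inf_slope:
  assumes h: "continuous_on {0..} h" and lim: "((\<lambda>t. h t / t) \<longlongrightarrow> p) at_top" and "p < 0"
  shows "((\<lambda>t. past_inf h t / t) \<longlongrightarrow> p) at_top"
proof (rule order_tendstoI)
  fix a assume "p < a"
  with lim have "eventually (\<lambda>t. h t / t < a) at_top" by (rule order_tendstoD)
  with eventually_gt_at_top[of 0] show "eventually (\<lambda>t. past_inf h t / t < a) at_top"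
  proof eventually_elim
    case (elim t)
    then have "past_inf h t / t \<le> h t / t" using past_inf_le[OF h, of t t] by (simp add: divide_right_mono)
    with elim show ?case by simp
  qed
next
  fix a assume "a < p"
  then obtain a' where a': "a < a'" "a' < p" using dense by blast
  from order_tendstoD(1)[OF lim a'(2)] obtain T\<^sub>0 where T\<^sub>0: "\<And>s. T\<^sub>0 \<le> s \<Longrightarrow> a' < h s / s"
    by (auto simp: eventually_at_top_linorder)
  \<comment> \<open>The maximum with 1 keeps \<open>s\<close> positive, so the bound on the quotient
    can be multiplied out.\<close>
  define T where "T = max T\<^sub>0 1"
  have T: "a' * s < h s" if "T \<le> s" for s
    using T\<^sub>0[of s] that by (simp add: T_def field_simps)
  have "((\<lambda>t. past_inf h T / t) \<longlongrightarrow> 0) at_top"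
    by (intro tendsto_divide_0[OF tendsto_const] filterlim_at_top_imp_at_infinity filterlim_ident)
  then have "eventually (\<lambda>t. a < past_inf h T / t) at_top"
    by (rule order_tendstoD) (use \<open>a < p\<close> \<open>p < 0\<close> in simp)
  with eventually_ge_at_top[of T] show "eventually (\<lambda>t. a < past_inf h t / t) at_top"
  proof eventually_elim
    case (elim t)
    then have t: "0 < t" by (simp add: T_def)
    obtain s where s: "0 \<le> s" "s \<le> t" "past_inf h t = h s"
      using past_inf_attained[OF h, of t] t by auto
    have "past_inf h T \<le> h s \<or> a' * t \<le> h s"
    proof (cases "T \<le> s")
      case True
      have "a' * t \<le> a' * s" using s a' \<open>p < 0\<close> by (simp add: mult_left_mono_neg)
      with T[OF True] show ?thesis by simp
    next
      case False
      then show ?thesis using past_inf_le[OF h, of s T] s by simp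
    qed
    then have "past_inf h T / t \<le> past_inf h t / t \<or> a' \<le> past_inf h t / t"
      using s t by (auto simp: field_simps)
    then show ?case using elim a' by linarith
  qed
qed

lemma future_inf_slope:
  assumes h: "continuous_on {0..} h" and lim: "((\<lambda>t. h t / t) \<longlongrightarrow> p) at_top" and "0 < p"
  shows "((\<lambda>t. future_inf h t / t) \<longlongrightarrow> p) at_top"
proof (rule order_tendstoI)
  note top = slope_at_top[OF lim \<open>0 < p\<close>]
  fix a assume "p < a"
  with lim have "eventually (\<lambda>t. h t / t < a) at_top" by (rule order_tendstoD)
  with eventually_gt_at_top[of 0] show "eventually (\<lambda>t. future_inf h t / t < a) at_top"
  proof eventually_elim
    case (elim t)
    then have "future_inf h t / t \<le> h t / t" using future_inf_le[OF h top, of t t] by (simp add: divide_right_mono)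
    with elim show ?case by simp
  qed
next
  note top = slope_at_top[OF lim \<open>0 < p\<close>]
  fix a assume "a < p"
  \<comment> \<open>The slope \<open>a'\<close> is taken positive so that the bound
    \<open>a' * s\<close> grows past \<open>t\<close>.\<close>
  then obtain a' where a': "max a 0 < a'" "a' < p" using dense[of "max a 0" p] \<open>0 < p\<close> by auto
  from order_tendstoD(1)[OF lim a'(2)] obtain T where T: "\<And>s. T \<le> s \<Longrightarrow> a' < h s / s"
    by (auto simp: eventually_at_top_linorder)
  from eventually_ge_at_top[of T] eventually_gt_at_top[of 0]
  show "eventually (\<lambda>t. a < future_inf h t / t) at_top"
  proof eventually_elim
    case (elim t)
    then have "0 \<le> t" by simp
    then obtain s where s: "t \<le> s" "future_inf h t = h s"
      by (rule future_inf_attained[OF h top])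
    have "a' * t \<le> a' * s" using s a' by simp
    also have "\<dots> < h s" using T[of s] s elim by (simp add: field_simps)
    finally have "a' < h s / t" using elim by (simp add: field_simps)
    then show ?case using s a' by simp
  qed
qed

text \<open>Common to both transforms: \<open>I\<close> is the past infimum with
  \<open>r = 0\<close>, or the future infimum with \<open>r\<close> its value at time 0.\<close>

lemma has_drift_correction:
  assumes "has_drift \<alpha> v \<eta>" and I: "((\<lambda>t. I t / t) \<longlongrightarrow> v \<bullet> coroot (\<alpha> i)) at_top"
    and eq: "\<And>t. 0 \<le> t \<Longrightarrow> \<eta>' t = \<eta> t - (I t - r) *\<^sub>R \<alpha> i"
  shows "has_drift \<alpha> (reflection (\<alpha> i) v) \<eta>'"
  unfolding has_drift_def
proof
  fix k
  have "((\<lambda>t. r / t) \<longlongrightarrow> 0) at_top"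
    by (intro tendsto_divide_0[OF tendsto_const] filterlim_at_top_imp_at_infinity filterlim_ident)
  then have "((\<lambda>t. (\<eta> t \<bullet> coroot (\<alpha> k)) / t - (I t / t - r / t) * (\<alpha> i \<bullet> coroot (\<alpha> k)))
      \<longlongrightarrow> v \<bullet> coroot (\<alpha> k) - (v \<bullet> coroot (\<alpha> i) - 0) * (\<alpha> i \<bullet> coroot (\<alpha> k))) at_top"
    using assms(1) by (intro tendsto_diff tendsto_mult tendsto_const I) (auto simp: has_drift_def)
  moreover have "eventually (\<lambda>t. (\<eta> t \<bullet> coroot (\<alpha> k)) / t - (I t / t - r / t) * (\<alpha> i \<bullet> coroot (\<alpha> k))
      = (\<eta>' t \<bullet> coroot (\<alpha> k)) / t) at_top"
    using eventually_gt_at_top[of 0]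
    by eventually_elim (simp add: eq inner_diff_left inner_add_left field_simps)
  ultimately show "((\<lambda>t. (\<eta>' t \<bullet> coroot (\<alpha> k)) / t) \<longlongrightarrow> reflection (\<alpha> i) v \<bullet> coroot (\<alpha> k)) at_top"
    using Lim_transform_eventually by (fastforce simp: reflection_def inner_diff_left)
qed

lemma has_drift_pitman:
  assumes "good_path \<eta>" "has_drift \<alpha> v \<eta>" "v \<bullet> coroot (\<alpha> i) < 0"
  shows "has_drift \<alpha> (reflection (\<alpha> i) v) (pitman (\<alpha> i) \<eta>)"
  using assms
  by (intro has_drift_correction[OF assms(2), of "past_inf (\<lambda>t. \<eta> t \<bullet> coroot (\<alpha> i))" i _ 0]
      past_inf_slope continuous_on_height)
    (auto simp: has_drift_def pitman_past_inf)

text \<open>The total map underlying the partial transform, so that continuity and drift can be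
  treated apart from the domain condition.\<close>

definition etrans_total :: "'a::euclidean_space \<Rightarrow> (real \<Rightarrow> 'a) \<Rightarrow> real \<Rightarrow> 'a" where
  "etrans_total b \<eta> t = \<eta> t
    - (future_inf (\<lambda>s. \<eta> s \<bullet> coroot b) t - future_inf (\<lambda>s. \<eta> s \<bullet> coroot b) 0) *\<^sub>R b"

lemma etrans_eq:
  assumes "filterlim (\<lambda>t. \<eta> t \<bullet> coroot b) at_top at_top"
  shows "etrans b \<eta> = Some (etrans_total b \<eta>)"
  using assms by (simp add: etrans_def etrans_total_def fun_eq_iff future_inf_def scaleR_diff_left)

lemma etrans_total_cong:
  assumes "\<And>s. 0 \<le> s \<Longrightarrow> \<eta> s = \<eta>' s" "0 \<le> t"
  shows "etrans_total b \<eta> t = etrans_total b \<eta>' t"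
  using assms future_inf_cong[of t "\<lambda>s. \<eta> s \<bullet> coroot b" "\<lambda>s. \<eta>' s \<bullet> coroot b"]
    future_inf_cong[of 0 "\<lambda>s. \<eta> s \<bullet> coroot b" "\<lambda>s. \<eta>' s \<bullet> coroot b"]
  by (simp add: etrans_total_def)

lemma good_etrans_total:
  assumes "good_path \<eta>" "filterlim (\<lambda>t. \<eta> t \<bullet> coroot b) at_top at_top"
  shows "good_path (etrans_total b \<eta>)"
  unfolding good_path_def
proof
  show "continuous_on {0..} (etrans_total b \<eta>)"
    unfolding etrans_total_def[abs_def] using assms
    by (intro continuous_intros continuous_on_future_inf continuous_on_height)
      (auto simp: good_path_def)
  show "etrans_total b \<eta> 0 = 0"
    using assms by (simp add: etrans_total_def good_path_def)
qed

lemma has_drift_etrans_total: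
  assumes "good_path \<eta>" "has_drift \<alpha> v \<eta>" "0 < v \<bullet> coroot (\<alpha> i)"
  shows "has_drift \<alpha> (reflection (\<alpha> i) v) (etrans_total (\<alpha> i) \<eta>)"
  using assms
  by (intro has_drift_correction[OF assms(2), of "future_inf (\<lambda>t. \<eta> t \<bullet> coroot (\<alpha> i))" i]
      future_inf_slope continuous_on_height)
    (auto simp: has_drift_def etrans_total_def)

lemma has_drift_height_at_top:
  "has_drift \<alpha> v \<eta> \<Longrightarrow> 0 < v \<bullet> coroot (\<alpha> i) \<Longrightarrow> filterlim (\<lambda>t. \<eta> t \<bullet> coroot (\<alpha> i)) at_top at_top"
  unfolding has_drift_def by (blast intro: slope_at_top)

text \<open>The future infimum of the transformed height is minus the past infimum of the original
  one: it is reached where the original height, on its way to minus infinity, next meets its current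
  minimum.\<close>

lemma etrans_total_pitman:
  assumes "good_path \<eta>" "b \<noteq> 0" and bot: "filterlim (\<lambda>t. \<eta> t \<bullet> coroot b) at_bot at_top" and "0 \<le> t"
  shows "etrans_total b (pitman b \<eta>) t = \<eta> t"
proof -
  define h where "h = (\<lambda>t. \<eta> t \<bullet> coroot b)"
  have h: "continuous_on {0..} h" unfolding h_def by (rule continuous_on_height[OF assms(1)])
  have h': "pitman b \<eta> s \<bullet> coroot b = h s - 2 * past_inf h s" for s
    by (simp add: pitman_height coroot_self[OF assms(2)] h_def)
  have future: "future_inf (\<lambda>s. h s - 2 * past_inf h s) t = - past_inf h t" if t: "0 \<le> t" for t
  proof -
    have "eventually (\<lambda>s. h s < past_inf h t) at_top"
      using bot by (simp add: h_def filterlim_at_bot_dense)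
    then have "eventually (\<lambda>s. t \<le> s \<and> h s < past_inf h t) at_top"
      using eventually_ge_at_top[of t] by eventually_elim simp
    then obtain T where T: "t \<le> T" "h T < past_inf h t"
      unfolding eventually_at_top_linorder by blast
    then have "past_inf h T < past_inf h t" using past_inf_le[OF h, of T T] t by simp
    then obtain s where s: "t \<le> s" "h s = past_inf h t" "past_inf h s = past_inf h t"
      using past_inf_first_hit[OF h t T(1)] by blast
    have le: "- past_inf h t \<le> h r - 2 * past_inf h r" if "t \<le> r" for r
      using past_inf_le[OF h, of r r] past_inf_antimono[OF h, of t r] t that by simp
    have "(INF r\<in>{t..}. h r - 2 * past_inf h r) = h s - 2 * past_inf h s"
      by (rule Inf_image_attained) (use s le in auto)
    then show ?thesis using s by (simp add: future_inf_def)
  qed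
  have "past_inf h 0 = 0" using assms(1) by (simp add: past_inf_def h_def good_path_def)
  then show ?thesis
    using \<open>0 \<le> t\<close> by (simp add: etrans_total_def h' future) (simp add: pitman_past_inf h_def)
qed

text \<open>The second transform subtracts \<open>J t - J 0\<close> times the root, and the past
  infimum of the height falls by the same amount, so the two changes cancel.\<close>

lemma pitman_etrans_total:
  assumes "good_path \<eta>" "b \<noteq> 0" and top: "filterlim (\<lambda>t. \<eta> t \<bullet> coroot b) at_top at_top" and t: "0 \<le> t"
  shows "pitman b (etrans_total b \<eta>) t = pitman b \<eta> t"
proof -
  define h where "h = (\<lambda>t. \<eta> t \<bullet> coroot b)"
  define J where "J = future_inf h"
  have h: "continuous_on {0..} h" unfolding h_def by (rule continuous_on_height[OF assms(1)])
  have top: "filterlim h at_top at_top" using top by (simp add: h_def)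
  have h': "etrans_total b \<eta> s \<bullet> coroot b = h s - 2 * J s + 2 * J 0" for s
    by (simp add: etrans_total_def inner_diff_left coroot_self[OF assms(2)] J_def h_def)
  have J_mono: "J r \<le> J s" if "0 \<le> r" "r \<le> s" for r s
    unfolding J_def by (rule future_inf_mono[OF h top that])
  have J_le: "J r \<le> h r" if "0 \<le> r" for r
    unfolding J_def by (rule future_inf_le[OF h top that]) simp
  have "\<exists>s. 0 \<le> s \<and> s \<le> t \<and> h s - 2 * J s = past_inf h t - J 0 - J t \<and>
      (\<forall>r. 0 \<le> r \<longrightarrow> r \<le> t \<longrightarrow> past_inf h t - J 0 - J t \<le> h r - 2 * J r)"
  proof (cases "J t = J 0")
    case True
    then have const: "J r = J 0" if "0 \<le> r" "r \<le> t" for r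
      using J_mono[of 0 r] J_mono[of r t] that by simp
    obtain s where "0 \<le> s" "s \<le> t" "past_inf h t = h s" by (rule past_inf_attained[OF h t])
    moreover have "past_inf h t - J 0 - J t \<le> h r - 2 * J r" if "0 \<le> r" "r \<le> t" for r
      using const[OF that] past_inf_le[OF h that] True by linarith
    moreover have "h s - 2 * J s = past_inf h t - J 0 - J t"
      using const[of s] True \<open>0 \<le> s\<close> \<open>s \<le> t\<close> \<open>past_inf h t = h s\<close> by linarith
    ultimately show ?thesis by blast
  next
    case False
    then have lt: "J 0 < J t" using J_mono[of 0 t] t by simp
    obtain q where q: "0 \<le> q" "J 0 = h q" "\<forall>r\<ge>0. h q \<le> h r"
      unfolding J_def by (rule future_inf_attained[OF h top order_refl]) blast
    have "q \<le> t"
    proof (rule ccontr)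
      assume "\<not> q \<le> t"
      then have "J t \<le> J q" using J_mono[of t q] t by simp
      then show False using lt q J_le[of q] by simp
    qed
    then have past: "past_inf h t = J 0"
      unfolding past_inf_def q(2) by (intro Inf_image_attained) (use q in auto)
    \<comment> \<open>At the last visit to the level \<open>J t\<close> the height and its future
      infimum coincide, so the new height is minimal there.\<close>
    obtain s where s: "0 \<le> s" "s \<le> t" "h s = J t" "J s = J t"
      using future_inf_last_hit[OF h top _ t] lt unfolding J_def by blast
    have "past_inf h t - J 0 - J t \<le> h r - 2 * J r" if "0 \<le> r" "r \<le> t" for r
      using J_le[of r] J_mono[of r t] that past by simp
    with s past show ?thesis by (intro exI[of _ s]) auto
  qed
  then obtain s where s: "0 \<le> s" "s \<le> t" "h s - 2 * J s = past_inf h t - J 0 - J t"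
    "\<And>r. 0 \<le> r \<Longrightarrow> r \<le> t \<Longrightarrow> past_inf h t - J 0 - J t \<le> h r - 2 * J r" by blast
  have "h s - 2 * J s + 2 * J 0 \<le> h r - 2 * J r + 2 * J 0" if "r \<in> {0..t}" for r
    using s(3) s(4)[of r] that by simp
  then have "past_inf (\<lambda>r. h r - 2 * J r + 2 * J 0) t = h s - 2 * J s + 2 * J 0"
    unfolding past_inf_def by (intro Inf_image_attained) (use s(1,2) in auto)
  then have "past_inf (\<lambda>r. h r - 2 * J r + 2 * J 0) t = past_inf h t + J 0 - J t" using s by simp
  then show ?thesis
    by (simp add: pitman_past_inf h' h_def[symmetric])
      (simp add: etrans_total_def h_def[symmetric] J_def algebra_simps)
qed

lemma pitman_dominant:
  assumes "good_path \<eta>" "\<And>s. 0 \<le> s \<Longrightarrow> 0 \<le> \<eta> s \<bullet> coroot b" "0 \<le> t"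
  shows "pitman b \<eta> t = \<eta> t"
proof -
  have "past_inf (\<lambda>s. \<eta> s \<bullet> coroot b) t = \<eta> 0 \<bullet> coroot b"
    unfolding past_inf_def by (rule Inf_image_attained) (use assms in \<open>auto simp: good_path_def\<close>)
  then show ?thesis using assms(1) by (simp add: pitman_past_inf good_path_def)
qed

lemma pitman_word_dominant:
  assumes "good_path \<eta>" "\<And>s. 0 \<le> s \<Longrightarrow> \<eta> s \<in> weyl_chamber \<alpha>" "0 \<le> t"
  shows "pitman_word \<alpha> u \<eta> t = \<eta> t"
  using assms(3)
proof (induction u arbitrary: t)
  case (Cons i u)
  have "pitman (\<alpha> i) (pitman_word \<alpha> u \<eta>) t = pitman (\<alpha> i) \<eta> t"
    by (rule pitman_cong) (use Cons in auto)
  also have "\<dots> = \<eta> t"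
    using assms Cons.prems by (intro pitman_dominant) (auto simp: weyl_chamber_def)
  finally show ?case by simp
qed simp

section \<open>Inversion along whole words\<close>

lemma etrans_word_simps [simp]:
  "etrans_word \<alpha> [] \<eta> = Some \<eta>"
  "etrans_word \<alpha> (i # u) \<eta> = Option.bind (etrans_word \<alpha> u \<eta>) (etrans (\<alpha> i))"
  by (simp_all add: etrans_word_def)

text \<open>With the word of \<open>P\<close> reversed, the last factor of \<open>P\<close> meets
  the first factor of \<open>E\<close>. The descent condition gives the negative drift that each
  cancellation requires.\<close>

lemma etrans_pitman_word:
  assumes "\<And>i. \<alpha> i \<noteq> 0"
    and "descending \<alpha> (rev u) v" "good_path \<xi>" "has_drift \<alpha> v \<xi>"
    and "\<And>t. 0 \<le> t \<Longrightarrow> \<eta> t = pitman_word \<alpha> (rev u) \<xi> t"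
  shows "\<exists>\<zeta>. etrans_word \<alpha> u \<eta> = Some \<zeta> \<and> (\<forall>t\<ge>0. \<zeta> t = \<xi> t)"
  using assms(2-)
proof (induction u arbitrary: v \<xi>)
  case (Cons j u)
  have j: "v \<bullet> coroot (\<alpha> j) < 0" and u: "descending \<alpha> (rev u) (reflection (\<alpha> j) v)"
    using Cons.prems(1) by auto
  have drift: "has_drift \<alpha> (reflection (\<alpha> j) v) (pitman (\<alpha> j) \<xi>)"
    by (rule has_drift_pitman[OF Cons.prems(2,3) j])
  obtain \<zeta> where \<zeta>: "etrans_word \<alpha> u \<eta> = Some \<zeta>" "\<And>t. 0 \<le> t \<Longrightarrow> \<zeta> t = pitman (\<alpha> j) \<xi> t"
    using Cons.IH[OF u good_pitman[OF Cons.prems(2)] drift] Cons.prems(4) by auto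
  have "0 < reflection (\<alpha> j) v \<bullet> coroot (\<alpha> j)"
    using j assms(1) by (simp add: reflection_def inner_diff_left coroot_self)
  then have "filterlim (\<lambda>t. pitman (\<alpha> j) \<xi> t \<bullet> coroot (\<alpha> j)) at_top at_top"
    by (rule has_drift_height_at_top[OF drift])
  \<comment> \<open>Equality is known at nonnegative times only; the domain condition of
    \<open>etrans\<close> concerns large times and transfers.\<close>
  moreover have "eventually (\<lambda>t. pitman (\<alpha> j) \<xi> t \<bullet> coroot (\<alpha> j) = \<zeta> t \<bullet> coroot (\<alpha> j)) at_top"
    using eventually_ge_at_top[of 0] by eventually_elim (simp add: \<zeta>)
  ultimately have "filterlim (\<lambda>t. \<zeta> t \<bullet> coroot (\<alpha> j)) at_top at_top"
    by (simp cong: filterlim_cong)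
  then have "etrans_word \<alpha> (j # u) \<eta> = Some (etrans_total (\<alpha> j) \<zeta>)"
    using \<zeta>(1) by (simp add: etrans_eq)
  moreover have "etrans_total (\<alpha> j) \<zeta> t = \<xi> t" if "0 \<le> t" for t
  proof -
    have "filterlim (\<lambda>t. \<xi> t \<bullet> coroot (\<alpha> j)) at_bot at_top"
      using Cons.prems(3) j unfolding has_drift_def by (blast intro: slope_at_bot)
    then have "etrans_total (\<alpha> j) (pitman (\<alpha> j) \<xi>) t = \<xi> t"
      using that by (intro etrans_total_pitman Cons.prems(2) assms(1))
    then show ?thesis using etrans_total_cong[OF \<zeta>(2) that] by simp
  qed
  ultimately show ?case by blast
qed simp

text \<open>For each letter, \<open>P\<close> may be rewritten so that this letter acts first, and
  \<open>pitman_etrans_total\<close> then makes the corresponding factor of \<open>E\<close>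
  invisible. Descent from \<open>- v\<close> supplies the positive pairings that define the
  factors.\<close>

lemma etrans_word_absorbed:
  assumes nz: "\<And>i. \<alpha> i \<noteq> 0"
    and P: "\<And>j. \<exists>u. \<forall>\<eta> t. good_path \<eta> \<longrightarrow> 0 \<le> t \<longrightarrow> P \<eta> t = pitman_word \<alpha> u (pitman (\<alpha> j) \<eta>) t"
    and "descending \<alpha> u (- v)" "good_path \<eta>" "has_drift \<alpha> v \<eta>"
  shows "\<exists>\<zeta>. etrans_word \<alpha> u \<eta> = Some \<zeta> \<and> good_path \<zeta> \<and> has_drift \<alpha> (weyl_word \<alpha> u v) \<zeta> \<and>
    (\<forall>t\<ge>0. P \<zeta> t = P \<eta> t)"
  using assms(3)
proof (induction u)
  case Nil
  then show ?case using assms by simp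
next
  case (Cons j u)
  then obtain \<zeta> where \<zeta>: "etrans_word \<alpha> u \<eta> = Some \<zeta>" "good_path \<zeta>" "has_drift \<alpha> (weyl_word \<alpha> u v) \<zeta>"
    "\<And>t. 0 \<le> t \<Longrightarrow> P \<zeta> t = P \<eta> t" by auto
  have j: "0 < weyl_word \<alpha> u v \<bullet> coroot (\<alpha> j)" using Cons.prems by (simp add: weyl_word_uminus)
  note top = has_drift_height_at_top[OF \<zeta>(3) j]
  note good = good_etrans_total[OF \<zeta>(2) top]
  obtain u' where u': "\<And>\<eta> t. good_path \<eta> \<Longrightarrow> 0 \<le> t \<Longrightarrow> P \<eta> t = pitman_word \<alpha> u' (pitman (\<alpha> j) \<eta>) t"
    using P[of j] by blast
  have "P (etrans_total (\<alpha> j) \<zeta>) t = P \<eta> t" if "0 \<le> t" for t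
  proof -
    have "P (etrans_total (\<alpha> j) \<zeta>) t = pitman_word \<alpha> u' (pitman (\<alpha> j) (etrans_total (\<alpha> j) \<zeta>)) t"
      by (rule u'[OF good that])
    also have "\<dots> = pitman_word \<alpha> u' (pitman (\<alpha> j) \<zeta>) t"
      using that by (intro pitman_word_cong pitman_etrans_total[OF \<zeta>(2) nz top])
    finally show ?thesis using u'[OF \<zeta>(2) that] \<zeta>(4)[OF that] by simp
  qed
  then show ?case
    using \<zeta> good has_drift_etrans_total[OF \<zeta>(2,3) j] by (simp add: etrans_eq[OF top])
qed

lemma (in root_basis) pitman_etrans_inverse:
  assumes m: "regular_dominant \<alpha> m" "longest_element \<alpha> w\<^sub>0" "reduced_decomposition \<alpha> w\<^sub>0 ws"
  shows "good_path \<eta> \<Longrightarrow> has_drift \<alpha> m \<eta> \<Longrightarrow> (\<And>t. 0 \<le> t \<Longrightarrow> \<eta> t \<in> weyl_chamber \<alpha>) \<Longrightarrow>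
      \<exists>\<zeta>. etrans_word \<alpha> ws \<eta> = Some \<zeta> \<and> (\<forall>t\<ge>0. pitman_word \<alpha> ws \<zeta> t = \<eta> t)"
    and "good_path \<xi> \<Longrightarrow> has_drift \<alpha> (w\<^sub>0 m) \<xi> \<Longrightarrow>
      \<exists>\<zeta>. etrans_word \<alpha> ws (pitman_word \<alpha> ws \<xi>) = Some \<zeta> \<and> (\<forall>t\<ge>0. \<zeta> t = \<xi> t)"
proof -
  assume \<eta>: "good_path \<eta>" "has_drift \<alpha> m \<eta>" "\<And>t. 0 \<le> t \<Longrightarrow> \<eta> t \<in> weyl_chamber \<alpha>"
  have "\<exists>u. \<forall>\<eta> t. good_path \<eta> \<longrightarrow> 0 \<le> t \<longrightarrow> pitman_word \<alpha> ws \<eta> t = pitman_word \<alpha> u (pitman (\<alpha> j) \<eta>) t" for j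
    using pitman_longest_last_letter[OF m, of j] by metis
  from etrans_word_absorbed[OF simple_nonzero this longest_word_descents(1)[OF m] \<eta>(1,2)]
  show "\<exists>\<zeta>. etrans_word \<alpha> ws \<eta> = Some \<zeta> \<and> (\<forall>t\<ge>0. pitman_word \<alpha> ws \<zeta> t = \<eta> t)"
    using pitman_word_dominant[OF \<eta>(1,3)] by metis
next
  assume \<xi>: "good_path \<xi>" "has_drift \<alpha> (w\<^sub>0 m) \<xi>"
  show "\<exists>\<zeta>. etrans_word \<alpha> ws (pitman_word \<alpha> ws \<xi>) = Some \<zeta> \<and> (\<forall>t\<ge>0. \<zeta> t = \<xi> t)"
    by (rule etrans_pitman_word[OF simple_nonzero longest_word_descents(2)[OF m] \<xi>])
      (rule pitman_longest_rev[OF m \<xi>(1)])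
qed

subsection \<open>Roots and trajectories\<close>

lemma root_basis_realized_roots:
  fixes \<alpha> :: "'n::finite \<Rightarrow> 'a::euclidean_space"
  assumes "lie_algebra scl bracket" and sr: "lie_algebra.simple_roots scl bracket H a"
    and rr: "root_realization scl bracket H a \<alpha>"
  shows "root_basis \<alpha> (realized_roots scl bracket H a \<alpha>)"
proof -
  let ?\<Phi> = "realized_roots scl bracket H a \<alpha>"
  have inj: "inj \<alpha>" and ind: "independent (range \<alpha>)"
    and refl: "\<And>\<beta>. \<beta> \<in> ?\<Phi> \<Longrightarrow> reflection \<beta> ` ?\<Phi> = ?\<Phi>"
    using rr by (auto simp: root_realization_def)
  interpret lie_algebra scl bracket by fact
  have root: "\<And>i. is_root H (a i)"
    and lin: "\<And>c i. \<forall>h\<in>H. (\<Sum>i\<in>UNIV. c i * a i h) = 0 \<Longrightarrow> c i = 0"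
    and sgn: "\<And>l. is_root H l \<Longrightarrow> \<exists>c :: 'n \<Rightarrow> int. (\<forall>h\<in>H. l h = (\<Sum>i\<in>UNIV. of_int (c i) * a i h)) \<and>
           ((\<forall>i. 0 \<le> c i) \<or> (\<forall>i. c i \<le> 0))"
    using sr unfolding simple_roots_def by blast+
  have simple: "\<alpha> i \<in> ?\<Phi>" for i
  proof -
    have "(\<lambda>h. \<Sum>k\<in>UNIV. of_int (if k = i then 1 else 0) * a k h) = a i"
      by (simp add: fun_eq_iff if_distrib[of of_int] if_distrib[of "\<lambda>x. x * _"] cong: if_cong)
    moreover have "\<alpha> i = (\<Sum>k\<in>UNIV. of_int (if k = i then 1 else 0) *\<^sub>R \<alpha> k)"
      by (simp add: if_distrib[of of_int] if_distrib[of "\<lambda>x. x *\<^sub>R _"] cong: if_cong)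
    ultimately show ?thesis
      unfolding realized_roots_def
      by (intro CollectI exI[of _ "\<lambda>k. if k = i then 1 else 0"]) (simp only: root simp_thms)
  qed
  have coeffs: "\<exists>c :: 'n \<Rightarrow> int. \<beta> = (\<Sum>i\<in>UNIV. of_int (c i) *\<^sub>R \<alpha> i) \<and>
      ((\<forall>i. 0 \<le> c i) \<or> (\<forall>i. c i \<le> 0)) \<and> (\<exists>i. c i \<noteq> 0)" if \<beta>: "\<beta> \<in> ?\<Phi>" for \<beta>
  proof -
    obtain c :: "'n \<Rightarrow> int" where c: "\<beta> = (\<Sum>i\<in>UNIV. of_int (c i) *\<^sub>R \<alpha> i)"
      and is_root: "is_root H (\<lambda>h. \<Sum>i\<in>UNIV. of_int (c i) * a i h)"
      using \<beta> unfolding realized_roots_def by blast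
    obtain d :: "'n \<Rightarrow> int" where
      d: "\<forall>h\<in>H. (\<Sum>i\<in>UNIV. of_int (c i) * a i h) = (\<Sum>i\<in>UNIV. of_int (d i) * a i h)"
      and sgn: "(\<forall>i. 0 \<le> d i) \<or> (\<forall>i. d i \<le> 0)"
      using sgn[OF is_root] by blast
    \<comment> \<open>The coefficients that realise the root and the coefficients of one sign agree
      on \<open>H\<close>, hence everywhere by independence of the simple roots.\<close>
    have "(of_int (c i) - of_int (d i) :: complex) = 0" for i
      using d by (intro lin[of "\<lambda>i. of_int (c i) - of_int (d i)"]) (simp add: left_diff_distrib sum_subtractf)
    then have "c = d" by (simp add: fun_eq_iff)
    moreover have "\<exists>i. c i \<noteq> 0"
    proof (rule ccontr)
      assume "\<not> ?thesis"
      then show False using is_root by (simp add: is_root_def)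
    qed
    ultimately show ?thesis using c sgn by blast
  qed
  show ?thesis
  proof
    fix \<beta> i assume \<beta>: "\<beta> \<in> ?\<Phi>"
    show "reflection (\<alpha> i) \<beta> \<in> ?\<Phi>" using refl[OF simple] \<beta> by blast
    show "\<exists>c :: 'n \<Rightarrow> int. \<beta> = (\<Sum>i\<in>UNIV. of_int (c i) *\<^sub>R \<alpha> i) \<and> ((\<forall>i. 0 \<le> c i) \<or> (\<forall>i. c i \<le> 0))"
      using coeffs[OF \<beta>] by blast
    obtain c :: "'n \<Rightarrow> int" and k where c: "\<beta> = (\<Sum>i\<in>UNIV. of_int (c i) *\<^sub>R \<alpha> i)" "c k \<noteq> 0"
      using coeffs[OF \<beta>] by blast
    show "\<beta> \<noteq> 0"
    proof
      assume "\<beta> = 0"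
      then have "(\<Sum>i\<in>UNIV. of_int (c i) *\<^sub>R \<alpha> i) = (\<Sum>i\<in>UNIV. 0 *\<^sub>R \<alpha> i)" using c by simp
      from independent_coefficients[OF inj ind this, of k] show False using c by simp
    qed
  qed (use inj ind simple in auto)
qed

lemma interior_chamber_regular_dominant:
  assumes "\<And>i. \<alpha> i \<noteq> 0" "m \<in> interior (weyl_chamber \<alpha>)"
  shows "regular_dominant \<alpha> m"
  unfolding regular_dominant_def
proof
  fix i
  obtain e where e: "0 < e" "ball m e \<subseteq> weyl_chamber \<alpha>"
    using assms(2) by (auto simp: mem_interior)
  \<comment> \<open>Half the radius of the ball, measured along the root; moving this far against
    the root lowers the pairing by \<open>2 * r\<close> and stays in the chamber.\<close>
  define r where "r = e / (2 * norm (\<alpha> i))"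
  have r: "0 < r" "norm (r *\<^sub>R \<alpha> i) < e" using e assms(1)[of i] by (simp_all add: r_def)
  then have "m - r *\<^sub>R \<alpha> i \<in> weyl_chamber \<alpha>" using e by (auto simp: dist_norm)
  then have "0 \<le> (m - r *\<^sub>R \<alpha> i) \<bullet> coroot (\<alpha> i)" by (simp add: weyl_chamber_def)
  then show "0 < m \<bullet> coroot (\<alpha> i)"
    using r by (simp add: inner_diff_left coroot_self[OF assms(1)])
qed

text \<open>The sum defining the drift of an infinite crystal would be \<open>0\<close>, which is not regular.\<close>

lemma crystal_finite:
  assumes "regular_dominant \<alpha> m" "m \<in> drifts \<alpha> \<kappa> \<pi>"
  shows "finite (crystal \<alpha> \<pi>)"
proof (rule ccontr)
  assume "infinite (crystal \<alpha> \<pi>)"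
  then have "m = 0" using assms(2) by (auto simp: drifts_def drift_def)
  then show False using assms(1) by (simp add: regular_dominant_def)
qed

section \<open>Continuity and growth of trajectories\<close>

lemma crystal_continuous:
  assumes "continuous_on {0..1} \<pi>" "\<pi> 0 = 0" "\<eta> \<in> crystal \<alpha> \<pi>"
  shows "continuous_on {0..1} \<eta> \<and> \<eta> 0 = 0"
  using assms(3)
proof induction
  case (step \<eta> i \<eta>')
  define h where "h = (\<lambda>t. \<eta> t \<bullet> coroot (\<alpha> i))"
  define M where "M = (INF t\<in>{0..1}. h t)"
  have \<eta>': "\<eta>' = restrict (\<lambda>t. \<eta> t - min 1 ((INF s\<in>{t..1}. h s) - M) *\<^sub>R \<alpha> i) {0..1}"
    using step.hyps(2) by (auto simp: root_op_def h_def M_def Let_def split: if_splits)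
  have "continuous_on {0..1} h" unfolding h_def using step.IH by (intro continuous_intros) auto
  then have "continuous_on {0..1} (\<lambda>t. \<eta> t - min 1 ((INF s\<in>{t..1}. h s) - M) *\<^sub>R \<alpha> i)"
    using step.IH by (intro continuous_intros continuous_on_interval_inf) auto
  then have "continuous_on {0..1} \<eta>'" by (rule continuous_on_eq) (simp add: \<eta>')
  \<comment> \<open>At time 0 the inner infimum runs over the whole interval and equals
    \<open>M\<close>, so the correction vanishes.\<close>
  moreover have "\<eta>' 0 = 0" using step.IH by (simp add: \<eta>' M_def)
  ultimately show ?case ..
qed (use assms in simp)

text \<open>The formula extends to the right endpoint, where the floor already selects the next
  path, because that path starts at 0.\<close>

lemma concat_paths_on_unit_interval:
  assumes "\<And>k. p k 0 = 0" "real k \<le> t" "t \<le> real k + 1"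
  shows "concat_paths p t = (\<Sum>j<k. p j 1) + p k (t - real k)"
proof (cases "t = real k + 1")
  case True
  then have "\<lfloor>t\<rfloor> = int (Suc k)" by simp
  then have "nat \<lfloor>t\<rfloor> = Suc k" "t - of_int \<lfloor>t\<rfloor> = 0" "t - real k = 1" "\<not> t < 0" using True by linarith+
  then show ?thesis using assms(1) by (simp add: concat_paths_def)
next
  case False
  then have "\<lfloor>t\<rfloor> = int k" using assms by (simp add: floor_eq_iff)
  then show ?thesis using assms by (simp add: concat_paths_def)
qed

lemma good_concat_paths:
  assumes cont: "\<And>k. continuous_on {0..1} (p k)" and zero: "\<And>k. p k 0 = 0"
  shows "good_path (concat_paths p)"
proof -
  have unit: "continuous_on {real k..real k + 1} (concat_paths p)" for k
  proof -
    have "continuous_on {real k..real k + 1} (\<lambda>t. (\<Sum>j<k. p j 1) + p k (t - real k))"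
      by (intro continuous_intros continuous_on_compose2[OF cont]) auto
    then show ?thesis
      by (rule continuous_on_eq) (simp add: concat_paths_on_unit_interval[of p k] zero)
  qed
  have upto: "continuous_on {0..real k} (concat_paths p)" for k
  proof (induction k)
    case (Suc k)
    have "{0..real (Suc k)} = {0..real k} \<union> {real k..real k + 1}" by auto
    then show ?case using Suc unit by (simp add: continuous_on_closed_Un)
  qed simp
  have "continuous_on {0..} (concat_paths p)"
    unfolding continuous_on_eq_continuous_within
  proof
    fix x :: real assume "x \<in> {0..}"
    obtain k :: nat where k: "x < real k" using reals_Archimedean2 by blast
    \<comment> \<open>Continuity is local, so a bounded interval reaching beyond \<open>x\<close>
      suffices.\<close>
    have "at x within {0..} = at x within {0..real k}"
      by (rule at_within_nhd[of _ "{..<real k}"]) (use k in auto)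
    moreover have "continuous (at x within {0..real k}) (concat_paths p)"
      using upto[of k] k \<open>x \<in> {0..}\<close> by (simp add: continuous_on_eq_continuous_within)
    ultimately show "continuous (at x within {0..}) (concat_paths p)" by simp
  qed
  moreover have "concat_paths p 0 = 0" using zero by (simp add: concat_paths_def)
  ultimately show ?thesis by (simp add: good_path_def)
qed

text \<open>With \<open>n\<close> the integer part of \<open>t\<close>, the quotient is that at
  \<open>n\<close> times \<open>n / t\<close>, which tends to 1, plus a bounded difference divided
  by \<open>t\<close>.\<close>

lemma slope_from_integers:
  fixes h :: "real \<Rightarrow> real"
  assumes lim: "(\<lambda>n. h (real n) / real n) \<longlonglongrightarrow> p"
    and bound: "\<And>t. 0 \<le> t \<Longrightarrow> \<bar>h t - h (real (nat \<lfloor>t\<rfloor>))\<bar> \<le> C"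
  shows "((\<lambda>t. h t / t) \<longlongrightarrow> p) at_top"
proof -
  define n where "n t = nat \<lfloor>t\<rfloor>" for t :: real
  have inv: "((\<lambda>t. c / t) \<longlongrightarrow> 0) at_top" for c :: real
    by (intro tendsto_divide_0[OF tendsto_const] filterlim_at_top_imp_at_infinity filterlim_ident)
  have "filterlim n sequentially at_top"
    unfolding n_def by (rule filterlim_compose[OF filterlim_nat_sequentially filterlim_floor_sequentially])
  from filterlim_compose[OF lim this] have lim_n: "((\<lambda>t. h (real (n t)) / real (n t)) \<longlongrightarrow> p) at_top" .
  have ratio: "((\<lambda>t. real (n t) / t) \<longlongrightarrow> 1) at_top"
  proof (rule tendsto_sandwich[of "\<lambda>t. 1 - 1 / t" _ _ "\<lambda>t. 1"])
    show "((\<lambda>t::real. 1 - 1 / t) \<longlongrightarrow> 1) at_top" using tendsto_diff[OF tendsto_const inv, of 1 1] by simp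
    show "eventually (\<lambda>t. 1 - 1 / t \<le> real (n t) / t) at_top"
      using eventually_gt_at_top[of 0]
    proof eventually_elim
      case (elim t)
      have "t - 1 \<le> real (n t)" using elim unfolding n_def by linarith
      from divide_right_mono[OF this, of t] show ?case using elim by (simp add: diff_divide_distrib)
    qed
    show "eventually (\<lambda>t. real (n t) / t \<le> 1) at_top"
      using eventually_gt_at_top[of 0]
    proof eventually_elim
      case (elim t)
      have "real (n t) \<le> t" using elim unfolding n_def by linarith
      then show ?case using elim by simp
    qed
  qed simp
  have "((\<lambda>t. (h t - h (real (n t))) / t) \<longlongrightarrow> 0) at_top"
  proof (rule Lim_null_comparison[OF _ inv[of C]])
    show "eventually (\<lambda>t. norm ((h t - h (real (n t))) / t) \<le> C / t) at_top"
      using eventually_gt_at_top[of 0]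
    proof eventually_elim
      case (elim t)
      then show ?case using divide_right_mono[OF bound[of t], of t] by (simp add: n_def)
    qed
  qed
  from tendsto_add[OF tendsto_mult[OF lim_n ratio] this]
  have "((\<lambda>t. h (real (n t)) / real (n t) * (real (n t) / t) + (h t - h (real (n t))) / t) \<longlongrightarrow> p) at_top"
    by simp
  moreover have "eventually (\<lambda>t. h (real (n t)) / real (n t) * (real (n t) / t)
      + (h t - h (real (n t))) / t = h t / t) at_top"
    using eventually_ge_at_top[of 1]
  proof eventually_elim
    case (elim t)
    then have "0 < n t" unfolding n_def by linarith
    then show ?case using elim by (simp add: field_simps)
  qed
  ultimately show ?thesis by (rule Lim_transform_eventually)
qed

text \<open>A finite set of continuous pieces is uniformly bounded, so between integer times a
  trajectory strays by at most a constant.\<close>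

lemma trajectory_good:
  assumes \<pi>: "continuous_on {0..1} \<pi>" "\<pi> 0 = 0" and fin: "finite (crystal \<alpha> \<pi>)"
    and \<eta>: "\<eta> \<in> traj \<alpha> \<pi>"
  shows "good_path \<eta>" and "has_mean \<alpha> v \<eta> \<Longrightarrow> has_drift \<alpha> v \<eta>"
proof -
  obtain p where p: "\<eta> = concat_paths p" "\<And>k. p k \<in> crystal \<alpha> \<pi>"
    using \<eta> by (auto simp: traj_def)
  have cont: "continuous_on {0..1} (p k)" and zero: "p k 0 = 0" for k
    using crystal_continuous[OF \<pi> p(2)] by auto
  show "good_path \<eta>" unfolding p(1) by (rule good_concat_paths[OF cont zero])
  have "bounded (\<Union>\<rho>\<in>crystal \<alpha> \<pi>. \<rho> ` {0..1})"
    using fin crystal_continuous[OF \<pi>]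
    by (intro bounded_UN) (auto intro: compact_imp_bounded compact_continuous_image)
  then obtain C where C: "\<And>k t. 0 \<le> t \<Longrightarrow> t \<le> 1 \<Longrightarrow> norm (p k t) \<le> C"
    unfolding bounded_iff using p(2) by (metis UN_I atLeastAtMost_iff imageI)
  assume mean: "has_mean \<alpha> v \<eta>"
  show "has_drift \<alpha> v \<eta>"
    unfolding has_drift_def
  proof
    fix i
    show "((\<lambda>t. \<eta> t \<bullet> coroot (\<alpha> i) / t) \<longlongrightarrow> v \<bullet> coroot (\<alpha> i)) at_top"
    proof (rule slope_from_integers)
      show "(\<lambda>n. \<eta> (real n) \<bullet> coroot (\<alpha> i) / real n) \<longlonglongrightarrow> v \<bullet> coroot (\<alpha> i)"
        using mean by (simp add: has_mean_def)
      fix t :: real assume t: "0 \<le> t"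
      define n where "n = nat \<lfloor>t\<rfloor>"
      have n: "real n \<le> t" "t \<le> real n + 1" using t unfolding n_def by linarith+
      have "\<eta> t - \<eta> (real n) = p n (t - real n)"
        using concat_paths_on_unit_interval[of p, OF zero n]
          concat_paths_on_unit_interval[of p n "real n", OF zero] zero by (simp add: p(1))
      then have "\<eta> t \<bullet> coroot (\<alpha> i) - \<eta> (real n) \<bullet> coroot (\<alpha> i) = p n (t - real n) \<bullet> coroot (\<alpha> i)"
        by (simp add: inner_diff_left[symmetric])
      also have "\<bar>\<dots>\<bar> \<le> norm (p n (t - real n)) * norm (coroot (\<alpha> i))" by (rule Cauchy_Schwarz_ineq2)
      also have "\<dots> \<le> C * norm (coroot (\<alpha> i))" using n by (intro mult_right_mono C) auto
      finally show "\<bar>\<eta> t \<bullet> coroot (\<alpha> i) - \<eta> (real (nat \<lfloor>t\<rfloor>)) \<bullet> coroot (\<alpha> i)\<bar> \<le> C * norm (coroot (\<alpha> i))"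
        unfolding n_def .
    qed
  qed
qed

theorem theorem8p10:
  fixes scl :: "complex \<Rightarrow> 'g::ab_group_add \<Rightarrow> 'g"
    and bracket :: "'g \<Rightarrow> 'g \<Rightarrow> 'g"
    and H :: "'g set"
    and a :: "'n::finite \<Rightarrow> 'g \<Rightarrow> complex"
    and \<alpha> :: "'n \<Rightarrow> 'a::euclidean_space"
    and w\<^sub>0 :: "'a \<Rightarrow> 'a" and ws :: "'n list"
    and \<kappa> m :: 'a and \<pi>\<^sub>\<kappa> :: "real \<Rightarrow> 'a"
  assumes "simple_lie_algebra scl bracket"
    and "lie_algebra.cartan_subalgebra scl bracket H"
    and "lie_algebra.simple_roots scl bracket H a"
    and "root_realization scl bracket H a \<alpha>"
    and "longest_element \<alpha> w\<^sub>0" and "reduced_decomposition \<alpha> w\<^sub>0 ws"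
    and "\<kappa> \<in> dominant_weights \<alpha>"
    and "elementary_path \<alpha> \<pi>\<^sub>\<kappa>" and "\<pi>\<^sub>\<kappa> 1 = \<kappa>" and "\<pi>\<^sub>\<kappa> ` {0..1} \<subseteq> weyl_chamber \<alpha>"
    and "m \<in> chamber_drifts \<alpha> \<kappa> \<pi>\<^sub>\<kappa>"
  shows "(\<forall>\<eta>\<in>traj_chamber_typ \<alpha> \<pi>\<^sub>\<kappa> m.
            \<exists>\<zeta>. etrans_word \<alpha> ws \<eta> = Some \<zeta> \<and> (\<forall>t\<ge>0. pitman_word \<alpha> ws \<zeta> t = \<eta> t)) \<and>
         (\<forall>\<xi>\<in>traj_iota_typ \<alpha> \<pi>\<^sub>\<kappa> w\<^sub>0 m.
            \<exists>\<zeta>. etrans_word \<alpha> ws (pitman_word \<alpha> ws \<xi>) = Some \<zeta> \<and> (\<forall>t\<ge>0. \<zeta> t = \<xi> t))"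
proof -
  interpret root_basis \<alpha> "realized_roots scl bracket H a \<alpha>"
    using assms(1,3,4) by (intro root_basis_realized_roots simple_lie_algebra.axioms(1))
  have m: "regular_dominant \<alpha> m"
    using assms(11) by (intro interior_chamber_regular_dominant) (auto simp: chamber_drifts_def)
  have fin: "finite (crystal \<alpha> \<pi>\<^sub>\<kappa>)"
    using assms(11) by (auto simp: chamber_drifts_def intro: crystal_finite[OF m])
  have \<pi>: "continuous_on {0..1} \<pi>\<^sub>\<kappa>" "\<pi>\<^sub>\<kappa> 0 = 0" using assms(8) by (auto simp: elementary_path_def)
  note good = trajectory_good[OF \<pi> fin] and inverse = pitman_etrans_inverse[OF m assms(5,6)]
  show ?thesis
    using good inverse
    by (intro conjI ballI) (auto simp: traj_chamber_typ_def traj_chamber_def traj_iota_typ_def)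
qed

end
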